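(* Let $N \geq 2$ be an integer. Then there exist positive integers $a$ and $b$ such that $N = a+b$ and $\Omega(ab) \leq 21$.
   Context: $\Omega(n)$ denotes the number of prime factors of $n$ counted with multiplicity. *)

theory Defs
  imports "HOL-Computational_Algebra.Primes"
begin

text \<open>
  The number of prime factors counted with multiplicity. Only positive arguments are
  meaningful; the value at \<open>0\<close> is \<open>0\<close>, since \<open>prime_factorization 0 = {#}\<close>.
\<close>

definition big_Omega :: "nat \<Rightarrow> nat"  (\<open>\<Omega>\<close>)
  where "\<Omega> n = size (prime_factorization n)"

end

theory Submission
  imports Defs "HOL-Analysis.Analysis" "HOL-Number_Theory.Number_Theory"
    "HOL-Computational_Algebra.Squarefree"
begin

text \<open>
  It suffices to find a nonempty set \<open>S\<close> of integers \<open>n\<close> with \<open>0 < n < N\<close>, invariant under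
  \<open>n \<mapsto> N - n\<close>, on which \<open>\<Omega> n\<close> has mean less than \<open>11\<close>: then \<open>\<Omega> n + \<Omega> (N - n) < 22\<close>
  for some \<open>n \<in> S\<close>. The mean is bounded by summing over the prime powers dividing \<open>n\<close>, with
  Mertens' estimate for the sum of the reciprocals of the primes. For \<open>N < 2^4096\<close> this works
  with all \<open>n\<close>. For larger \<open>N\<close> the primes between \<open>16\<close> and a power \<open>z\<close> of
  \<open>2\<close> with \<open>N^(1/256) < z \<le> N^(1/128)\<close> are first sifted out of \<open>n (N - n)\<close>; this leaves
  only the primes up to \<open>16\<close>, those from \<open>z\<close> to about \<open>sqrt N\<close>, which contribute about
  \<open>ln (log z (sqrt N))\<close>, and at most one larger prime power (with rare exceptions). The
  sifted set is counted with the Brun-Hooley sieve: the primes are cut into blocks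
  \<open>(2^(4 * 2^i), 2^(4 * 2^(i + 1))]\<close>, on each of which inclusion-exclusion is truncated at an
  even level that grows as the primes get smaller. As \<open>11\<close> leaves room for a large ratio
  \<open>log N / log z\<close>, crude truncation levels suffice.
\<close>

subsection \<open>The Brun-Hooley sieve\<close>

text \<open>The coefficient of a subset depends only on its size. Leaving it general lets one
  counting lemma treat truncated alternating sums, elementary symmetric sums, and mixtures of the
  two over different blocks.\<close>

definition msum :: "(nat \<Rightarrow> real) \<Rightarrow> ('a \<Rightarrow> real) \<Rightarrow> 'a set \<Rightarrow> real"
  where "msum c g P = (\<Sum>T\<in>Pow P. c (card T) * (\<Prod>p\<in>T. g p))"

definition esym :: "nat \<Rightarrow> ('a \<Rightarrow> real) \<Rightarrow> 'a set \<Rightarrow> real"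
  where "esym r = msum (\<lambda>i. of_bool (i = r))"

text \<open>Inclusion-exclusion for the product of the \<open>1 - g p\<close>, cut off after the
  subsets of size \<open>b\<close>.\<close>

definition bonf :: "nat \<Rightarrow> ('a \<Rightarrow> real) \<Rightarrow> 'a set \<Rightarrow> real"
  where "bonf b = msum (\<lambda>i. of_bool (i \<le> b) * (- 1) ^ i)"

lemma msum_empty [simp]: "msum c g {} = c 0"
  by (simp add: msum_def)

text \<open>The subsets are split by membership of \<open>x\<close>; removing \<open>x\<close>
  shifts the coefficients by one.\<close>

lemma msum_insert:
  assumes "finite P" "x \<notin> P"
  shows "msum c g (insert x P) = msum c g P + g x * msum (\<lambda>i. c (Suc i)) g P"
proof -
  have inj: "inj_on (insert x) (Pow P)"
    using assms by (auto simp: inj_on_def)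
  have "(\<Sum>T\<in>insert x ` Pow P. c (card T) * prod g T) = g x * msum (\<lambda>i. c (Suc i)) g P"
    unfolding msum_def sum.reindex[OF inj] sum_distrib_left
  proof (rule sum.cong)
    fix T assume "T \<in> Pow P"
    then have "finite T" "x \<notin> T"
      using assms finite_subset by auto
    then show "((\<lambda>T. c (card T) * prod g T) \<circ> insert x) T = g x * (c (Suc (card T)) * prod g T)"
      by simp
  qed simp
  moreover have "Pow P \<inter> insert x ` Pow P = {}"
    using assms by auto
  ultimately show ?thesis
    using assms by (simp add: msum_def Pow_insert sum.union_disjoint)
qed

lemma msum_cmult: "msum (\<lambda>i. a * c i) g P = a * msum c g P"
  by (simp add: msum_def sum_distrib_left mult.assoc)

lemma msum_zero [simp]: "msum (\<lambda>i. 0) g P = 0"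
  by (simp add: msum_def)

lemma msum_mono:
  assumes "\<And>i. c i \<le> d i" "\<And>p. p \<in> P \<Longrightarrow> g p \<ge> 0"
  shows "msum c g P \<le> msum d g P"
  unfolding msum_def using assms by (intro sum_mono mult_right_mono prod_nonneg) auto

lemma msum_nonneg:
  assumes "\<And>i. c i \<ge> 0" "\<And>p. p \<in> P \<Longrightarrow> g p \<ge> 0"
  shows "msum c g P \<ge> 0"
  unfolding msum_def using assms by (intro sum_nonneg mult_nonneg_nonneg prod_nonneg) auto

lemma esym_insert_0: "finite P \<Longrightarrow> x \<notin> P \<Longrightarrow> esym 0 g (insert x P) = esym 0 g P"
  by (simp add: esym_def msum_insert)

lemma esym_insert_Suc:
  "finite P \<Longrightarrow> x \<notin> P \<Longrightarrow> esym (Suc r) g (insert x P) = esym (Suc r) g P + g x * esym r g P"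
  by (simp add: esym_def msum_insert)

lemma bonf_insert_0: "finite P \<Longrightarrow> x \<notin> P \<Longrightarrow> bonf 0 g (insert x P) = bonf 0 g P"
  by (simp add: bonf_def msum_insert)

lemma bonf_insert_Suc:
  assumes "finite P" "x \<notin> P"
  shows "bonf (Suc b) g (insert x P) = bonf (Suc b) g P - g x * bonf b g P"
proof -
  have "msum (\<lambda>i. of_bool (Suc i \<le> Suc b) * (- 1) ^ Suc i) g P = msum (\<lambda>i. - 1 * (of_bool (i \<le> b) * (- 1) ^ i)) g P"
    by (rule arg_cong[where f = "\<lambda>c. msum c g P"]) (auto simp: fun_eq_iff)
  then show ?thesis
    unfolding bonf_def by (subst msum_insert[OF assms]) (simp only: msum_cmult)
qed

lemma esym_0: "finite P \<Longrightarrow> esym 0 g P = 1"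
  by (induction P rule: finite_induct) (simp_all add: esym_insert_0, simp add: esym_def)

text \<open>Induction over \<open>P\<close> for all \<open>b\<close> at once: inserting
  \<open>x\<close> adds to the signed error at level \<open>Suc b'\<close> the value
  \<open>g x\<close> times the signed error at level \<open>b'\<close>, and \<open>esym\<close>
  obeys the same recurrence. Values between 0 and 1 are allowed so that it serves both for
  indicators and for densities.\<close>

lemma bonferroni:
  assumes "finite P" "\<And>p. p \<in> P \<Longrightarrow> 0 \<le> g p \<and> g p \<le> 1"
  shows "0 \<le> (- 1) ^ b * (bonf b g P - (\<Prod>p\<in>P. 1 - g p)) \<and>
         (- 1) ^ b * (bonf b g P - (\<Prod>p\<in>P. 1 - g p)) \<le> esym (Suc b) g P"
  using assms
proof (induction P arbitrary: b rule: finite_induct)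
  case empty
  then show ?case by (simp add: bonf_def esym_def)
next
  case (insert x P)
  let ?V = "\<Prod>p\<in>P. 1 - g p"
  have g: "0 \<le> g x" "g x \<le> 1" and V: "0 \<le> ?V" "?V \<le> 1"
    using insert.prems by (auto intro!: prod_nonneg prod_le_1)
  have IH: "0 \<le> (- 1) ^ b * (bonf b g P - ?V)" "(- 1) ^ b * (bonf b g P - ?V) \<le> esym (Suc b) g P" for b
    using insert.IH[of b] insert.prems by auto
  show ?case
  proof (cases b)
    case 0
    have "g x * ?V \<ge> 0" "g x * ?V \<le> g x"
      using g V by (auto intro: mult_left_le)
    then show ?thesis
      using IH[of 0] insert.hyps 0
      by (simp add: bonf_insert_0 esym_insert_Suc esym_0 left_diff_distrib)
  next
    case (Suc b')
    have eq: "(- 1) ^ b * (bonf b g (insert x P) - (\<Prod>p\<in>insert x P. 1 - g p)) =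
      (- 1) ^ b * (bonf b g P - ?V) + g x * ((- 1) ^ b' * (bonf b' g P - ?V))"
      unfolding Suc bonf_insert_Suc[OF insert.hyps]
      using insert.hyps by (simp add: algebra_simps)
    show ?thesis
      unfolding eq esym_insert_Suc[OF insert.hyps]
      using IH[of b] mult_left_mono[OF IH(2)[of b'] g(1)] mult_nonneg_nonneg[OF g(1) IH(1)[of b']]
      unfolding Suc by linarith
  qed
qed

text \<open>With \<open>s\<close> the sum before \<open>x\<close> is inserted, the recurrence of
  \<open>esym\<close> is matched against the first two terms of the binomial expansion of
  \<open>(s + g x) ^ r\<close>.\<close>

lemma esym_le:
  assumes "finite P" "\<And>p. p \<in> P \<Longrightarrow> 0 \<le> g p"
  shows "esym r g P \<le> (\<Sum>p\<in>P. g p) ^ r / fact r"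
  using assms
proof (induction P arbitrary: r rule: finite_induct)
  case empty
  then show ?case by (cases r) (auto simp: esym_def)
next
  case (insert x P)
  define s where "s = (\<Sum>p\<in>P. g p)"
  have g: "0 \<le> g x" and s: "0 \<le> s"
    using insert.prems by (auto simp: s_def intro!: sum_nonneg)
  show ?case
  proof (cases r)
    case 0
    then show ?thesis using insert.hyps by (simp add: esym_0)
  next
    case (Suc r')
    have pow: "s ^ Suc q + Suc q * g x * s ^ q \<le> (s + g x) ^ Suc q" for q
    proof (induction q)
      case (Suc q)
      have "s ^ Suc (Suc q) + Suc (Suc q) * g x * s ^ Suc q
          \<le> (s ^ Suc q + Suc q * g x * s ^ q) * (s + g x)"
        using g s by (simp add: algebra_simps)
      also have "\<dots> \<le> (s + g x) ^ Suc q * (s + g x)"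
        using Suc.IH g s by (intro mult_right_mono) auto
      finally show ?case by (simp add: mult.commute)
    qed simp
    have "esym r g (insert x P) \<le> s ^ r / fact r + g x * (s ^ r' / fact r')"
      unfolding Suc esym_insert_Suc[OF insert.hyps] s_def
      using insert.IH insert.prems g by (intro add_mono mult_left_mono) (auto simp del: fact_Suc power_Suc)
    also have "\<dots> = (s ^ Suc r' + Suc r' * g x * s ^ r') / fact r"
    proof -
      have "s ^ Suc r' / fact (Suc r') + g x * (s ^ r' / F) = (s ^ Suc r' + Suc r' * g x * s ^ r') / (Suc r' * F)"
        if "fact (Suc r') = Suc r' * F" "F > 0" for F :: real
        unfolding that(1) using that(2) by (simp add: divide_simps del: power_Suc)
      then show ?thesis unfolding Suc by (simp del: power_Suc)
    qed
    also have "\<dots> \<le> (s + g x) ^ r / fact r"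
      unfolding Suc using pow[of r'] by (intro divide_right_mono) auto
    finally show ?thesis
      using insert.hyps by (simp add: s_def add.commute)
  qed
qed

lemma esym_nonneg: "(\<And>p. p \<in> P \<Longrightarrow> 0 \<le> g p) \<Longrightarrow> 0 \<le> esym r g P"
  unfolding esym_def by (rule msum_nonneg) auto

section \<open>Counting in residue classes\<close>

definition hits :: "nat \<Rightarrow> nat \<Rightarrow> nat \<Rightarrow> real"
  where "hits N n p = of_bool (p dvd n * (N - n))"

text \<open>The expected value of \<open>hits\<close>: a prime \<open>p\<close> divides
  \<open>n * (N - n)\<close> exactly when \<open>n\<close> is 0 or \<open>N\<close> modulo
  \<open>p\<close>, and the two classes coincide if \<open>p\<close> divides
  \<open>N\<close>.\<close>

definition dens :: "nat \<Rightarrow> nat \<Rightarrow> real"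
  where "dens N p = (if p dvd N then 1 else 2) / real p"

text \<open>In \<open>{..<N}\<close> a class occurs the floor or the ceiling of \<open>N / m\<close>
  times. Omitting 0 affects only the class of 0, whose count there is the ceiling, so the error
  remains at most 1.\<close>

lemma count_class:
  fixes N m a :: nat
  assumes "m > 0"
  shows "\<bar>real (card {n \<in> {1..<N}. [n = a] (mod m)}) - real N / real m\<bar> \<le> 1"
proof (cases "N = 0")
  case True
  then show ?thesis by simp
next
  case False
  define r where "r = a mod m"
  have r: "r < m" using assms by (simp add: r_def)
  define k where "k = card {n \<in> {..<N}. [n = a] (mod m)}"
  have "{n \<in> {..<N}. [n = a] (mod m)} = (\<lambda>i. i * m + r) ` {i. i * m + r < N}"
  proof (intro Set.set_eqI iffI)
    fix n assume "n \<in> {n \<in> {..<N}. [n = a] (mod m)}"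
    then have "n < N" "n = n div m * m + r"
      by (auto simp: cong_def r_def) (metis mult.commute mult_div_mod_eq)
    then show "n \<in> (\<lambda>i. i * m + r) ` {i. i * m + r < N}"
      by (intro image_eqI[of _ _ "n div m"]) auto
  qed (auto simp: cong_def r_def)
  \<comment> \<open>The ceiling of \<open>(N - r) / m\<close>, written so that no subtraction of
    natural numbers is truncated.\<close>
  moreover have "{i. i * m + r < N} = {..<(N + m - 1 - r) div m}"
  proof -
    have "i * m + r < N \<longleftrightarrow> i < (N + m - 1 - r) div m" for i
    proof -
      have "i < (N + m - 1 - r) div m \<longleftrightarrow> Suc i * m \<le> N + m - 1 - r"
        using assms by (metis Suc_le_eq less_eq_div_iff_mult_less_eq)
      then show ?thesis using r by auto
    qed
    then show ?thesis by auto
  qed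
  ultimately have k: "k = (N + m - 1 - r) div m"
    unfolding k_def using assms by (simp add: card_image inj_on_def)
  have "k * m \<le> N + m - 1 - r" "N + m - 1 - r < k * m + m"
    unfolding k using dividend_less_div_times[OF assms, of "N + m - 1 - r"] by (simp_all add: add.commute)
  then have k1: "k * m + 1 + r \<le> N + m" "N \<le> k * m + r"
    using r by auto
  show ?thesis
  proof (cases "r = 0")
    case True
    have eq: "{n \<in> {..<N}. [n = a] (mod m)} = insert 0 {n \<in> {1..<N}. [n = a] (mod m)}"
      using True False by (auto simp: cong_def r_def)
    have "card (insert 0 {n \<in> {1..<N}. [n = a] (mod m)}) = Suc (card {n \<in> {1..<N}. [n = a] (mod m)})"
      by (rule card_insert_disjoint) auto
    then have "k = Suc (card {n \<in> {1..<N}. [n = a] (mod m)})"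
      unfolding k_def eq .
    then have c: "real (card {n \<in> {1..<N}. [n = a] (mod m)}) = real k - 1" by simp
    have "real k * real m \<le> real N + real m" "real N \<le> real k * real m"
      using k1 True unfolding of_nat_mult[symmetric] of_nat_add[symmetric] of_nat_le_iff by auto
    then show ?thesis
      unfolding c using assms by (auto simp: abs_le_iff field_simps)
  next
    case r0: False
    have "{n \<in> {..<N}. [n = a] (mod m)} = {n \<in> {1..<N}. [n = a] (mod m)}"
      using r0 by (auto simp: cong_def r_def Suc_le_eq intro: gr0I)
    then have c: "card {n \<in> {1..<N}. [n = a] (mod m)} = k"
      unfolding k_def by simp
    have "k * m \<le> N + m" "N \<le> k * m + m"
      using k1 r by auto
    then have "real k * real m \<le> real N + real m" "real N \<le> real k * real m + real m"
      unfolding of_nat_mult[symmetric] of_nat_add[symmetric] of_nat_le_iff by auto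
    then show ?thesis
      unfolding c using assms by (auto simp: abs_le_iff field_simps)
  qed
qed

text \<open>By the Chinese remainder theorem each prime of \<open>D\<close> splits a class into at
  most two classes to a larger modulus. In the end there are at most \<open>2 ^ card D\<close>
  classes, each counted with error at most 1.\<close>

lemma sum_hits_class:
  assumes "finite D" "\<And>p. p \<in> D \<Longrightarrow> prime p \<and> coprime p m" "m > 0"
  shows "\<bar>(\<Sum>n | n \<in> {1..<N} \<and> [n = a] (mod m). \<Prod>p\<in>D. hits N n p)
      - real N / real m * (\<Prod>p\<in>D. dens N p)\<bar> \<le> 2 ^ card D"
  using assms
proof (induction D arbitrary: m a rule: finite_induct)
  case empty
  then show ?case using count_class[of m N a] by simp
next
  case (insert q D)
  let ?A = "\<lambda>m a. {n. n \<in> {1..<N} \<and> [n = a] (mod m)}"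
  let ?h = "\<lambda>n. \<Prod>p\<in>D. hits N n p"
  let ?d = "\<Prod>p\<in>D. dens N p"
  have q: "prime q" "coprime m q" "q > 0"
    using insert.prems(1)[of q] by (auto simp: coprime_commute prime_gt_0_nat)
  have IH: "\<bar>sum ?h (?A (m * q) c) - real N / real (m * q) * ?d\<bar> \<le> 2 ^ card D" for c
  proof (rule insert.IH)
    fix p assume p: "p \<in> D"
    then have "p \<noteq> q" "prime p" "coprime p m" using insert by auto
    then show "prime p \<and> coprime p (m * q)"
      using q by (auto simp: primes_coprime)
  qed (use insert.prems q in auto)
  have split: "[n = c] (mod m * q) \<longleftrightarrow> [n = a] (mod m) \<and> [n = u] (mod q)"
    if "[c = a] (mod m)" "[c = u] (mod q)" for n c u
  proof -
    have "[n = c] (mod m * q) \<longleftrightarrow> [n = c] (mod m) \<and> [n = c] (mod q)"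
      using q(2) coprime_cong_mult_nat[of n c m q] cong_modulus_mult_nat[of n c m q]
        cong_modulus_mult_nat[of n c q m] by (auto simp: mult.commute)
    then show ?thesis using that by (meson cong_sym cong_trans)
  qed
  \<comment> \<open>Both lift the class of \<open>a\<close> to the modulus \<open>m * q\<close>:
    \<open>c0\<close> makes \<open>q\<close> divide \<open>n\<close>, \<open>c1\<close> makes it
    divide \<open>N - n\<close>.\<close>
  obtain c0 where c0: "[c0 = a] (mod m)" "[c0 = 0] (mod q)"
    using binary_chinese_remainder_nat[OF q(2)] by blast
  obtain c1 where c1: "[c1 = a] (mod m)" "[c1 = N] (mod q)"
    using binary_chinese_remainder_nat[OF q(2)] by blast
  have dvd0: "q dvd n \<longleftrightarrow> [n = 0] (mod q)" for n
    by (simp add: cong_0_iff)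
  have dvd1: "q dvd (N - n) \<longleftrightarrow> [n = N] (mod q)" if "n \<in> {1..<N}" for n
    using that by (metis atLeastLessThan_iff cong_altdef_nat cong_sym_eq less_imp_le_nat)
  have eq: "(\<Sum>n\<in>?A m a. \<Prod>p\<in>insert q D. hits N n p) = sum ?h {n \<in> ?A m a. q dvd n * (N - n)}"
  proof -
    have "(\<Sum>n\<in>?A m a. \<Prod>p\<in>insert q D. hits N n p) = (\<Sum>n\<in>?A m a. if q dvd n * (N - n) then ?h n else 0)"
      using insert.hyps by (intro sum.cong) (auto simp: hits_def)
    also have "\<dots> = sum ?h {n \<in> ?A m a. q dvd n * (N - n)}"
      by (subst sum.inter_filter) auto
    finally show ?thesis .
  qed
  have set: "{n \<in> ?A m a. q dvd n * (N - n)} = ?A (m * q) c0 \<union> ?A (m * q) c1"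
    using dvd1 unfolding prime_dvd_mult_iff[OF q(1)] split[OF c0] split[OF c1] dvd0[symmetric] by auto
  show ?case
  proof (cases "q dvd N")
    case True
    then have "[c1 = 0] (mod q)" using c1 by (meson cong_0_iff cong_trans)
    then have "?A (m * q) c1 = ?A (m * q) c0"
      unfolding split[OF c0] split[OF c1(1) \<open>[c1 = 0] (mod q)\<close>] by blast
    then have "sum ?h {n \<in> ?A m a. q dvd n * (N - n)} = sum ?h (?A (m * q) c0)"
      unfolding set by simp
    moreover have "real N / real m * (\<Prod>p\<in>insert q D. dens N p) = real N / real (m * q) * ?d"
      using insert.hyps True by (simp add: dens_def)
    ultimately show ?thesis
      unfolding eq using order.trans[OF IH[of c0], of "2 ^ card (insert q D)"] insert.hyps by simp
  next
    case False
    have "?A (m * q) c0 \<inter> ?A (m * q) c1 = {}"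
      unfolding split[OF c0] split[OF c1] using False
      by (auto simp: cong_0_iff) (use cong_dvd_iff in blast)
    then have "sum ?h {n \<in> ?A m a. q dvd n * (N - n)} = sum ?h (?A (m * q) c0) + sum ?h (?A (m * q) c1)"
      unfolding set by (subst sum.union_disjoint) auto
    moreover have "real N / real m * (\<Prod>p\<in>insert q D. dens N p) = 2 * (real N / real (m * q) * ?d)"
      using insert.hyps False by (simp add: dens_def)
    ultimately show ?thesis
      unfolding eq using abs_triangle_ineq[of "sum ?h (?A (m * q) c0) - real N / real (m * q) * ?d"
          "sum ?h (?A (m * q) c1) - real N / real (m * q) * ?d"] IH[of c0] IH[of c1] insert.hyps
      by (simp only: card_insert_disjoint power_Suc) (simp add: abs_le_iff)
  qed
qed

text \<open>The product is expanded one block at a time, and \<open>D\<close> collects the primes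
  chosen so far, which is what the induction needs. The error is the total absolute weight, with a
  factor 2 for each chosen prime. The modulus \<open>m\<close> will serve to count multiples in the
  sifted set.\<close>

lemma sum_blocks_class:
  assumes "finite J" "\<And>j. j \<in> J \<Longrightarrow> finite (P j)"
    "\<And>i j. i \<in> J \<Longrightarrow> j \<in> J \<Longrightarrow> i \<noteq> j \<Longrightarrow> P i \<inter> P j = {}"
    "\<And>j p. j \<in> J \<Longrightarrow> p \<in> P j \<Longrightarrow> prime p \<and> coprime p m \<and> p \<notin> D"
    "finite D" "\<And>p. p \<in> D \<Longrightarrow> prime p \<and> coprime p m" "m > 0"
  shows "\<bar>(\<Sum>n | n \<in> {1..<N} \<and> [n = a] (mod m).
        (\<Prod>p\<in>D. hits N n p) * (\<Prod>j\<in>J. msum (c j) (hits N n) (P j)))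
      - real N / real m * (\<Prod>p\<in>D. dens N p) * (\<Prod>j\<in>J. msum (c j) (dens N) (P j))\<bar>
    \<le> 2 ^ card D * (\<Prod>j\<in>J. msum (\<lambda>i. \<bar>c j i\<bar>) (\<lambda>_. 2) (P j))"
  using assms
proof (induction J arbitrary: D rule: finite_induct)
  case empty
  then show ?case using sum_hits_class[of D m N a] by simp
next
  case (insert j J)
  let ?A = "{n. n \<in> {1..<N} \<and> [n = a] (mod m)}"
  define F where "F n = (\<Prod>i\<in>J. msum (c i) (hits N n) (P i))" for n
  define G where "G = (\<Prod>i\<in>J. msum (c i) (dens N) (P i))"
  define H where "H = (\<Prod>i\<in>J. msum (\<lambda>l. \<bar>c i l\<bar>) (\<lambda>_. 2) (P i))"
  have H: "H \<ge> 0" unfolding H_def by (intro prod_nonneg) (auto intro: msum_nonneg)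
  have finP: "finite (P j)" using insert.prems by auto
  have IH: "\<bar>(\<Sum>n\<in>?A. (\<Prod>p\<in>D \<union> T. hits N n p) * F n) - real N / real m * (\<Prod>p\<in>D \<union> T. dens N p) * G\<bar>
    \<le> 2 ^ card (D \<union> T) * H" if "T \<in> Pow (P j)" for T
    unfolding F_def G_def H_def
  proof (rule insert.IH)
    fix i p assume i: "i \<in> J" and p: "p \<in> P i"
    then have "i \<noteq> j" using insert.hyps by auto
    then have "P i \<inter> P j = {}" using insert.prems(2)[of i j] i by auto
    then show "prime p \<and> coprime p m \<and> p \<notin> D \<union> T"
      using that insert.prems(3)[of i p] i p by auto
  next
    show "finite (D \<union> T)" using insert.prems that finite_subset[OF _ finP, of T] by auto
  next
    fix p assume "p \<in> D \<union> T"
    then show "prime p \<and> coprime p m"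
      using insert.prems(3)[of j p] insert.prems(5) that by auto
  qed (use insert.prems in auto)
  have disj: "D \<inter> T = {}" "finite T" if "T \<in> Pow (P j)" for T
    using that insert.prems(3)[of j] finite_subset[OF _ finP, of T] by auto
  have expand: "(\<Prod>p\<in>D. g p) * (msum (c j) g (P j) * X)
      = (\<Sum>T\<in>Pow (P j). c j (card T) * ((\<Prod>p\<in>D \<union> T. g p) * X))" for g X
  proof -
    have "(\<Prod>p\<in>D. g p) * (msum (c j) g (P j) * X)
      = (\<Sum>T\<in>Pow (P j). c j (card T) * ((\<Prod>p\<in>D. g p) * (\<Prod>p\<in>T. g p) * X))"
      unfolding msum_def sum_distrib_left sum_distrib_right by (simp add: mult_ac)
    also have "\<dots> = (\<Sum>T\<in>Pow (P j). c j (card T) * ((\<Prod>p\<in>D \<union> T. g p) * X))"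
      using disj insert.prems(4) by (intro sum.cong) (simp_all add: prod.union_disjoint)
    finally show ?thesis .
  qed
  have l: "(\<Sum>n\<in>?A. (\<Prod>p\<in>D. hits N n p) * (msum (c j) (hits N n) (P j) * F n))
     = (\<Sum>T\<in>Pow (P j). c j (card T) * (\<Sum>n\<in>?A. (\<Prod>p\<in>D \<union> T. hits N n p) * F n))"
    unfolding expand sum_distrib_left by (rule sum.swap)
  have r: "real N / real m * (\<Prod>p\<in>D. dens N p) * (msum (c j) (dens N) (P j) * G)
     = (\<Sum>T\<in>Pow (P j). c j (card T) * (real N / real m * (\<Prod>p\<in>D \<union> T. dens N p) * G))"
    unfolding mult.assoc expand unfolding sum_distrib_left by (simp add: mult_ac)
  have "\<bar>(\<Sum>T\<in>Pow (P j). c j (card T) * (\<Sum>n\<in>?A. (\<Prod>p\<in>D \<union> T. hits N n p) * F n)) -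
      (\<Sum>T\<in>Pow (P j). c j (card T) * (real N / real m * (\<Prod>p\<in>D \<union> T. dens N p) * G))\<bar>
     \<le> (\<Sum>T\<in>Pow (P j). \<bar>c j (card T)\<bar> * (2 ^ card (D \<union> T) * H))"
    unfolding sum_subtractf[symmetric] right_diff_distrib[symmetric]
    by (rule order.trans[OF sum_abs], unfold abs_mult, rule sum_mono, rule mult_left_mono[OF IH]) auto
  also have "\<dots> = (\<Sum>T\<in>Pow (P j). \<bar>c j (card T)\<bar> * (\<Prod>p\<in>T. 2) * (2 ^ card D * H))"
    using disj insert.prems(4) by (intro sum.cong) (simp_all add: card_Un_disjoint power_add)
  also have "\<dots> = 2 ^ card D * (msum (\<lambda>i. \<bar>c j i\<bar>) (\<lambda>_. 2) (P j) * H)"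
    unfolding msum_def sum_distrib_right[symmetric] by simp
  finally show ?case
    unfolding l[symmetric] r[symmetric] using insert.hyps by (simp add: F_def G_def H_def)
qed


section \<open>Upper and lower bounds for the sifted set\<close>

definition sifted :: "nat \<Rightarrow> 'i set \<Rightarrow> ('i \<Rightarrow> nat set) \<Rightarrow> nat set"
  where "sifted N J P = {n \<in> {1..<N}. \<forall>j\<in>J. \<forall>p\<in>P j. \<not> p dvd n * (N - n)}"

text \<open>Sum of the weights \<open>2 ^ card T\<close>, which bound the number of residue classes to be counted.\<close>

definition cost :: "nat \<Rightarrow> 'a set \<Rightarrow> real"
  where "cost b = msum (\<lambda>i. of_bool (i \<le> Suc b)) (\<lambda>_. 2)"

text \<open>If all \<open>x j\<close> are 1, the products agree. If some \<open>x j\<close> is 0,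
  then \<open>y j <= e j\<close>, and the product of the \<open>y\<close> is already covered by the
  summand of that \<open>j\<close>. Lower bounds for single factors, which could be negative, are
  thus never multiplied.\<close>

lemma hooley:
  fixes x y e :: "'i \<Rightarrow> real"
  assumes "finite J" "\<And>j. j \<in> J \<Longrightarrow> x j = 0 \<or> x j = 1" "\<And>j. j \<in> J \<Longrightarrow> 0 \<le> y j"
    "\<And>j. j \<in> J \<Longrightarrow> 0 \<le> e j" "\<And>j. j \<in> J \<Longrightarrow> y j \<le> x j + e j" "\<And>j. j \<in> J \<Longrightarrow> x j = 1 \<Longrightarrow> y j = 1"
  shows "(\<Prod>j\<in>J. y j) - (\<Sum>j\<in>J. \<Prod>i\<in>J. if i = j then e i else y i) \<le> (\<Prod>j\<in>J. x j)"
proof (cases "\<forall>j\<in>J. x j = 1")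
  case True
  then have "(\<Prod>j\<in>J. y j) = (\<Prod>j\<in>J. x j)"
    using assms by (intro prod.cong) auto
  moreover have "(\<Sum>j\<in>J. \<Prod>i\<in>J. if i = j then e i else y i) \<ge> 0"
    using assms by (intro sum_nonneg prod_nonneg) auto
  ultimately show ?thesis by simp
next
  case False
  then obtain j where j: "j \<in> J" "x j = 0" using assms by blast
  have "(\<Prod>i\<in>J. y i) \<le> (\<Prod>i\<in>J. if i = j then e i else y i)"
    using assms(3) assms(5)[of j] j by (intro prod_mono) auto
  also have "\<dots> \<le> (\<Sum>j\<in>J. \<Prod>i\<in>J. if i = j then e i else y i)"
    using assms j by (intro member_le_sum) (auto intro!: prod_nonneg)
  finally show ?thesis using j assms(1) by (simp add: prod_zero[of J x] bexI[of _ j])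
qed

context
  fixes N :: nat and J :: "'i set" and P :: "'i \<Rightarrow> nat set" and b :: "'i \<Rightarrow> nat"
  assumes J: "finite J" and P: "\<And>j. j \<in> J \<Longrightarrow> finite (P j)"
    and disj: "\<And>i j. i \<in> J \<Longrightarrow> j \<in> J \<Longrightarrow> i \<noteq> j \<Longrightarrow> P i \<inter> P j = {}"
    and prime: "\<And>j p. j \<in> J \<Longrightarrow> p \<in> P j \<Longrightarrow> prime p"
    and even: "\<And>j. j \<in> J \<Longrightarrow> even (b j)"
begin

private lemma hits01: "0 \<le> hits N n p" "hits N n p \<le> 1"
  by (auto simp: hits_def)

private lemma sum_blocks:
  assumes "m > 0" "\<And>j p. j \<in> J \<Longrightarrow> p \<in> P j \<Longrightarrow> coprime p m"
  shows "\<bar>(\<Sum>n | n \<in> {1..<N} \<and> [n = a] (mod m). \<Prod>j\<in>J. msum (c j) (hits N n) (P j))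
      - real N / real m * (\<Prod>j\<in>J. msum (c j) (dens N) (P j))\<bar>
    \<le> (\<Prod>j\<in>J. msum (\<lambda>i. \<bar>c j i\<bar>) (\<lambda>_. 2) (P j))"
  using sum_blocks_class[where J = J and P = P and m = m and D = "{}" and N = N and a = a
      and c = c, OF J P disj] prime assms by simp

private lemma sum_blocks_1:
  "\<bar>(\<Sum>n\<in>{1..<N}. \<Prod>j\<in>J. msum (c j) (hits N n) (P j))
      - real N * (\<Prod>j\<in>J. msum (c j) (dens N) (P j))\<bar>
    \<le> (\<Prod>j\<in>J. msum (\<lambda>i. \<bar>c j i\<bar>) (\<lambda>_. 2) (P j))"
proof -
  have "{n. n \<in> {1..<N} \<and> [n = 0] (mod 1)} = {1..<N}" by auto
  then show ?thesis using sum_blocks[where m = 1 and a = 0 and c = c] by (simp only:) simp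
qed

private lemma sifted_indicator:
  assumes "n \<in> {1..<N}"
  shows "(\<Prod>j\<in>J. \<Prod>p\<in>P j. 1 - hits N n p) = of_bool (n \<in> sifted N J P)"
proof (cases "n \<in> sifted N J P")
  case True
  then have "(\<Prod>j\<in>J. \<Prod>p\<in>P j. 1 - hits N n p) = (\<Prod>j\<in>J. \<Prod>p\<in>P j. 1)"
    by (intro prod.cong) (auto simp: sifted_def hits_def)
  then show ?thesis using True by simp
next
  case False
  then obtain j p where jp: "j \<in> J" "p \<in> P j" "p dvd n * (N - n)"
    using assms by (auto simp: sifted_def)
  then have "(\<Prod>p\<in>P j. 1 - hits N n p) = 0"
    using P by (auto simp: prod_zero_iff hits_def)
  then show ?thesis using jp(1) J False by (auto simp: prod_zero_iff)
qed

private lemma bonf_hits: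
  assumes "j \<in> J"
  shows "(\<Prod>p\<in>P j. 1 - hits N n p) \<le> bonf (b j) (hits N n) (P j)"
    "bonf (b j) (hits N n) (P j) \<le> (\<Prod>p\<in>P j. 1 - hits N n p) + esym (Suc (b j)) (hits N n) (P j)"
  using bonferroni[OF P[OF assms], of "hits N n" "b j"] even[OF assms] hits01 by auto

private lemma hits_prod01: "j \<in> J \<Longrightarrow> (\<Prod>p\<in>P j. 1 - hits N n p) = 0 \<or> (\<Prod>p\<in>P j. 1 - hits N n p) = 1"
  by (cases "\<exists>p\<in>P j. hits N n p = 1") (use P in \<open>auto simp: prod_zero_iff hits_def\<close>)

text \<open>One error bound serves both the alternating sum at level \<open>b'\<close> and the
  elementary symmetric sum of degree \<open>Suc b'\<close>.\<close>

lemma cost_ge: "msum (\<lambda>i. \<bar>of_bool (i \<le> b') * (- 1) ^ i\<bar>) (\<lambda>_. 2) Q \<le> cost b' Q"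
  "msum (\<lambda>i. \<bar>of_bool (i = Suc b')\<bar>) (\<lambda>_. 2) Q \<le> cost b' Q"
  unfolding cost_def by (intro msum_mono; auto simp: abs_mult)+

text \<open>At even levels the truncated sums of all blocks lie above the indicators, so their
  product does too. Coprimality keeps the condition \<open>m dvd n\<close> independent of the
  sieve.\<close>

lemma sifted_upper:
  assumes m: "m > 0" "\<And>j p. j \<in> J \<Longrightarrow> p \<in> P j \<Longrightarrow> coprime p m"
  shows "real (card {n \<in> sifted N J P. m dvd n})
    \<le> real N / real m * (\<Prod>j\<in>J. bonf (b j) (dens N) (P j)) + (\<Prod>j\<in>J. cost (b j) (P j))"
proof -
  let ?A = "{n. n \<in> {1..<N} \<and> [n = 0] (mod m)}"
  have "{n \<in> sifted N J P. m dvd n} = {n \<in> ?A. n \<in> sifted N J P}"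
    by (auto simp: sifted_def cong_0_iff)
  then have "real (card {n \<in> sifted N J P. m dvd n}) = (\<Sum>n\<in>?A. of_bool (n \<in> sifted N J P))"
    by (simp add: of_bool_def sum.If_cases Int_def)
  also have "\<dots> = (\<Sum>n\<in>?A. \<Prod>j\<in>J. \<Prod>p\<in>P j. 1 - hits N n p)"
    using sifted_indicator by (intro sum.cong) auto
  also have "\<dots> \<le> (\<Sum>n\<in>?A. \<Prod>j\<in>J. bonf (b j) (hits N n) (P j))"
    using bonf_hits hits01 by (intro sum_mono prod_mono) (auto intro!: prod_nonneg)
  also have "\<dots> \<le> real N / real m * (\<Prod>j\<in>J. bonf (b j) (dens N) (P j))
      + (\<Prod>j\<in>J. msum (\<lambda>i. \<bar>of_bool (i \<le> b j) * (- 1) ^ i\<bar>) (\<lambda>_. 2) (P j))"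
  proof -
    have "\<bar>(\<Sum>n\<in>?A. \<Prod>j\<in>J. bonf (b j) (hits N n) (P j)) - real N / real m * (\<Prod>j\<in>J. bonf (b j) (dens N) (P j))\<bar>
        \<le> (\<Prod>j\<in>J. msum (\<lambda>i. \<bar>of_bool (i \<le> b j) * (- 1) ^ i\<bar>) (\<lambda>_. 2) (P j))"
      unfolding bonf_def by (rule sum_blocks) (use m in auto)
    then show ?thesis by linarith
  qed
  also have "\<dots> \<le> real N / real m * (\<Prod>j\<in>J. bonf (b j) (dens N) (P j)) + (\<Prod>j\<in>J. cost (b j) (P j))"
    by (intro add_left_mono prod_mono) (auto simp: cost_ge intro!: msum_nonneg)
  finally show ?thesis .
qed

text \<open>The inequality \<open>hooley\<close> is summed over \<open>n\<close>, with
  \<open>esym\<close> as the possible excess of \<open>bonf\<close>. The main sum and each of the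
  \<open>card J\<close> side sums incur the counting error once, hence the factor
  \<open>Suc (card J)\<close>.\<close>

lemma sifted_lower:
  assumes pos: "\<And>j. j \<in> J \<Longrightarrow> bonf (b j) (dens N) (P j) > 0"
  shows "real (card (sifted N J P)) \<ge> real N * (\<Prod>j\<in>J. bonf (b j) (dens N) (P j))
      * (1 - (\<Sum>j\<in>J. esym (Suc (b j)) (dens N) (P j) / bonf (b j) (dens N) (P j)))
    - real (Suc (card J)) * (\<Prod>j\<in>J. cost (b j) (P j))"
proof -
  let ?G = "\<lambda>j. bonf (b j) (dens N) (P j)"
  let ?E = "\<lambda>j. esym (Suc (b j)) (dens N) (P j)"
  let ?K = "\<Prod>j\<in>J. cost (b j) (P j)"
  let ?y = "\<lambda>n j. bonf (b j) (hits N n) (P j)"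
  let ?e = "\<lambda>n j. esym (Suc (b j)) (hits N n) (P j)"
  have main: "real N * (\<Prod>j\<in>J. ?G j) - ?K \<le> (\<Sum>n\<in>{1..<N}. \<Prod>j\<in>J. ?y n j)"
  proof -
    have "real N * (\<Prod>j\<in>J. ?G j) - (\<Prod>j\<in>J. msum (\<lambda>i. \<bar>of_bool (i \<le> b j) * (- 1) ^ i\<bar>) (\<lambda>_. 2) (P j))
        \<le> (\<Sum>n\<in>{1..<N}. \<Prod>j\<in>J. ?y n j)"
      using sum_blocks_1[where c = "\<lambda>j i. of_bool (i \<le> b j) * (- 1) ^ i"]
      unfolding bonf_def abs_le_iff by linarith
    moreover have "(\<Prod>j\<in>J. msum (\<lambda>i. \<bar>of_bool (i \<le> b j) * (- 1) ^ i\<bar>) (\<lambda>_. 2) (P j)) \<le> ?K"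
      by (intro prod_mono) (auto simp: cost_ge intro!: msum_nonneg)
    ultimately show ?thesis by linarith
  qed
  have side: "(\<Sum>n\<in>{1..<N}. \<Prod>i\<in>J. if i = j then ?e n i else ?y n i)
      \<le> real N * (\<Prod>j\<in>J. ?G j) * (?E j / ?G j) + ?K" if j: "j \<in> J" for j
  proof -
    \<comment> \<open>Coefficients of \<open>esym\<close> in block \<open>j\<close> and of
      \<open>bonf\<close> in all others, so that the side sum is a single instance of the counting
      lemma.\<close>
    define c where "c i = (if i = j then (\<lambda>l. of_bool (l = Suc (b i))) else (\<lambda>l. of_bool (l \<le> b i) * (- 1) ^ l :: real))" for i
    have c: "msum (c i) g (P i) = (if i = j then esym (Suc (b i)) g (P i) else bonf (b i) g (P i))" for i and g :: "nat \<Rightarrow> real"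
      by (simp add: c_def esym_def bonf_def)
    have "(\<Sum>n\<in>{1..<N}. \<Prod>i\<in>J. if i = j then ?e n i else ?y n i)
       \<le> real N * (\<Prod>i\<in>J. if i = j then ?E i else ?G i) + (\<Prod>i\<in>J. msum (\<lambda>l. \<bar>c i l\<bar>) (\<lambda>_. 2) (P i))"
      using sum_blocks_1[where c = c] unfolding c abs_le_iff by linarith
    moreover have "(\<Prod>i\<in>J. msum (\<lambda>l. \<bar>c i l\<bar>) (\<lambda>_. 2) (P i)) \<le> ?K"
      using cost_ge by (intro prod_mono) (auto simp: c_def intro!: msum_nonneg)
    moreover have "(\<Prod>i\<in>J. if i = j then ?E i else ?G i) = (\<Prod>i\<in>J. ?G i) * (?E j / ?G j)"
    proof -
      have "(\<Prod>i\<in>J - {j}. if i = j then ?E i else ?G i) = (\<Prod>i\<in>J - {j}. ?G i)"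
        by (intro prod.cong) auto
      then show ?thesis
        using pos[OF j] by (simp add: prod.remove[OF J j])
    qed
    ultimately show ?thesis by (simp add: mult.assoc)
  qed
  have "real N * (\<Prod>j\<in>J. ?G j) * (1 - (\<Sum>j\<in>J. ?E j / ?G j)) - real (Suc (card J)) * ?K
     = (real N * (\<Prod>j\<in>J. ?G j) - ?K) - (\<Sum>j\<in>J. real N * (\<Prod>j\<in>J. ?G j) * (?E j / ?G j) + ?K)"
    unfolding sum.distrib sum_distrib_left[symmetric] by (simp add: algebra_simps)
  also have "\<dots> \<le> (\<Sum>n\<in>{1..<N}. \<Prod>j\<in>J. ?y n j) - (\<Sum>j\<in>J. \<Sum>n\<in>{1..<N}. \<Prod>i\<in>J. if i = j then ?e n i else ?y n i)"
    by (intro diff_mono main sum_mono side)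
  also have "\<dots> = (\<Sum>n\<in>{1..<N}. (\<Prod>j\<in>J. ?y n j) - (\<Sum>j\<in>J. \<Prod>i\<in>J. if i = j then ?e n i else ?y n i))"
    unfolding sum_subtractf by (subst sum.swap) simp
  also have "\<dots> \<le> (\<Sum>n\<in>{1..<N}. \<Prod>j\<in>J. \<Prod>p\<in>P j. 1 - hits N n p)"
  proof (intro sum_mono hooley J)
    fix n j assume j: "j \<in> J"
    show x01: "(\<Prod>p\<in>P j. 1 - hits N n p) = 0 \<or> (\<Prod>p\<in>P j. 1 - hits N n p) = 1"
      by (rule hits_prod01[OF j])
    then show "0 \<le> ?y n j"
      using bonf_hits(1)[OF j, of n] by linarith
    show e: "0 \<le> ?e n j" by (intro esym_nonneg hits01)
    show "?y n j \<le> (\<Prod>p\<in>P j. 1 - hits N n p) + ?e n j"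
      by (rule bonf_hits(2)[OF j])
    assume x1: "(\<Prod>p\<in>P j. 1 - hits N n p) = 1"
    have "hits N n p = 0" if "p \<in> P j" for p
    proof (rule ccontr)
      assume "hits N n p \<noteq> 0"
      then have "1 - hits N n p = 0" by (simp add: hits_def)
      then have "(\<Prod>p\<in>P j. 1 - hits N n p) = 0" using P[OF j] that by (intro prod_zero) auto
      then show False using x1 by simp
    qed
    \<comment> \<open>Without a hit the excess \<open>esym\<close> vanishes, which forces
      \<open>bonf\<close> to equal 1.\<close>
    then have "(\<Sum>p\<in>P j. hits N n p) = 0" by simp
    then have "?e n j \<le> 0"
      using esym_le[OF P[OF j], of "hits N n" "Suc (b j)"] hits01 by simp
    then show "?y n j = 1"
      using bonf_hits[OF j, of n] x1 by linarith
  qed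
  also have "\<dots> = (\<Sum>n\<in>{1..<N}. of_bool (n \<in> sifted N J P))"
    by (intro sum.cong sifted_indicator) auto
  also have "\<dots> = real (card (sifted N J P))"
  proof -
    have "{1..<N} \<inter> {n. n \<in> sifted N J P} = sifted N J P" by (auto simp: sifted_def)
    then show ?thesis by (simp add: of_bool_def sum.If_cases)
  qed
  finally show ?thesis .
qed

end

subsection \<open>Mertens' estimate\<close>

abbreviation primes_le :: "nat \<Rightarrow> nat set"
  where "primes_le x \<equiv> {p. prime p \<and> p \<le> x}"

definition prime_harm :: "nat \<Rightarrow> real"
  where "prime_harm x = (\<Sum>p\<in>primes_le x. 1 / real p)"

lemma finite_primes_le [simp]: "finite (primes_le x)"
  by (rule finite_subset[of _ "{..x}"]) auto

lemma card_multiples: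
  assumes "d > 0"
  shows "card {m \<in> {1..n}. d dvd m} = n div d"
proof -
  have "{m \<in> {1..n}. d dvd m} = (\<lambda>i. i * d) ` {1..n div d}"
  proof (intro Set.set_eqI iffI)
    fix m assume "m \<in> {m \<in> {1..n}. d dvd m}"
    then obtain i where i: "m = i * d" "1 \<le> m" "m \<le> n" by (auto elim!: dvdE simp: mult.commute)
    then have "i \<le> n div d" using assms by (simp add: less_eq_div_iff_mult_less_eq)
    with i show "m \<in> (\<lambda>i. i * d) ` {1..n div d}"
      by (intro image_eqI[of _ _ i]) (auto simp: Suc_le_eq intro: gr0I)
  next
    fix m assume "m \<in> (\<lambda>i. i * d) ` {1..n div d}"
    then show "m \<in> {m \<in> {1..n}. d dvd m}"
      using assms by (auto simp: less_eq_div_iff_mult_less_eq Suc_le_eq)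
  qed
  then show ?thesis using assms by (simp add: card_image inj_on_def)
qed

text \<open>The product of the distinct primes dividing \<open>m\<close> divides
  \<open>m\<close>.\<close>

lemma sum_ln_prime_divisors_le:
  assumes "m > 0"
  shows "(\<Sum>p | prime p \<and> p dvd m. ln (real p)) \<le> ln (real m)"
proof -
  have eq: "{p. prime p \<and> p dvd m} = prime_factors m"
    using assms by (auto simp: in_prime_factors_iff)
  have "(\<Prod>p\<in>prime_factors m. p) dvd (\<Prod>p\<in>prime_factors m. p ^ multiplicity p m)"
    by (intro prod_dvd_prod dvd_power) (auto simp: prime_factors_multiplicity)
  also have "\<dots> = m"
    using assms by (simp add: prime_factorization_nat[symmetric])
  finally have "(\<Prod>p\<in>prime_factors m. p) dvd m" .
  then have "(\<Prod>p\<in>prime_factors m. p) \<le> m" using assms by (rule dvd_imp_le)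
  then have "real (\<Prod>p\<in>prime_factors m. p) \<le> real m" by (simp only: of_nat_le_iff)
  moreover have "real (\<Prod>p\<in>prime_factors m. p) > 0"
    by (auto simp: in_prime_factors_iff prime_gt_0_nat intro!: prod_pos)
  ultimately have "ln (real (\<Prod>p\<in>prime_factors m. p)) \<le> ln (real m)" by simp
  moreover have "ln (real (\<Prod>p\<in>prime_factors m. p)) = (\<Sum>p\<in>prime_factors m. ln (real p))"
    by (subst of_nat_prod, rule ln_prod) (auto simp: in_prime_factors_iff prime_gt_0_nat)
  ultimately show ?thesis unfolding eq by simp
qed

text \<open>The sum of \<open>ln p\<close> over primes \<open>p\<close> dividing \<open>m\<close> is
  summed over all \<open>m <= n\<close> in two ways. The choice \<open>n = 4 * x\<close> makes
  \<open>n div p >= 4\<close> for all \<open>p <= x\<close>, so rounding down loses at most the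
  factor 4/5.\<close>

lemma sum_ln_over_prime_le:
  assumes "x > 0"
  shows "(\<Sum>p\<in>primes_le x. ln (real p) / real p) \<le> 5 / 4 * ln (real (4 * x))"
proof -
  define n where "n = 4 * x"
  have n: "n > 0" using assms by (simp add: n_def)
  have "(\<Sum>p\<in>primes_le x. ln (real p) * (4 / 5 * (real n / real p))) \<le> (\<Sum>p\<in>primes_le x. ln (real p) * real (n div p))"
  proof (intro sum_mono mult_left_mono)
    fix p assume "p \<in> primes_le x"
    then have p: "p > 0" "p \<le> x" "1 \<le> p" by (auto simp: prime_gt_0_nat Suc_le_eq)
    have 4: "4 \<le> n div p" using p by (simp add: n_def less_eq_div_iff_mult_less_eq)
    have "n < (n div p) * p + p" using p dividend_less_div_times[of p n] by simp
    then have "real n < real (n div p) * real p + real p"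
      unfolding of_nat_mult[symmetric] of_nat_add[symmetric] of_nat_less_iff .
    also have "\<dots> = (real (n div p) + 1) * real p" by (simp add: algebra_simps)
    also have "\<dots> \<le> (5 / 4 * real (n div p)) * real p"
      using 4 by (intro mult_right_mono) auto
    finally show "4 / 5 * (real n / real p) \<le> real (n div p)"
      using p by (simp add: field_simps)
    show "0 \<le> ln (real p)" using p by simp
  qed
  also have "\<dots> = (\<Sum>p\<in>primes_le x. \<Sum>m | m \<in> {1..n} \<and> p dvd m. ln (real p))"
    by (intro sum.cong) (auto simp: card_multiples[symmetric] prime_gt_0_nat)
  also have "\<dots> = (\<Sum>m\<in>{1..n}. \<Sum>p | p \<in> primes_le x \<and> p dvd m. ln (real p))"
    by (rule sum.swap_restrict) auto
  also have "\<dots> \<le> (\<Sum>m\<in>{1..n}. \<Sum>p | prime p \<and> p dvd m. ln (real p))"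
  proof (intro sum_mono sum_mono2)
    fix m assume "m \<in> {1..n}"
    then show "finite {p. prime p \<and> p dvd m}"
      using finite_subset[of "{p. prime p \<and> p dvd m}" "{..m}"] by (auto dest: dvd_imp_le)
  qed (auto simp: prime_gt_0_nat Suc_le_eq)
  also have "\<dots> \<le> (\<Sum>m\<in>{1..n}. ln (real n))"
  proof (intro sum_mono)
    fix m assume "m \<in> {1..n}"
    then show "(\<Sum>p | prime p \<and> p dvd m. ln (real p)) \<le> ln (real n)"
      using order.trans[OF sum_ln_prime_divisors_le[of m]] by auto
  qed
  also have "\<dots> = real n * ln (real n)" by simp
  also have "(\<Sum>p\<in>primes_le x. ln (real p) * (4 / 5 * (real n / real p)))
      = 4 / 5 * real n * (\<Sum>p\<in>primes_le x. ln (real p) / real p)"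
    by (simp add: sum_distrib_left mult_ac)
  finally show ?thesis using n by (simp add: n_def field_simps)
qed

text \<open>For completely multiplicative \<open>f\<close>, expanding the product gives the values
  at the squarefree numbers composed of these primes. Both Mertens bounds use this.\<close>

lemma prod_1_plus_primes:
  fixes f :: "nat \<Rightarrow> real"
  assumes "f 1 = 1" "\<And>a b. f (a * b) = f a * f b"
  shows "(\<Prod>p\<in>primes_le x. 1 + f p) = (\<Sum>T\<in>Pow (primes_le x). f (\<Prod>T))"
proof -
  have f: "f (\<Prod>T) = (\<Prod>p\<in>T. f p)" if "finite T" for T
    using that by (induction T rule: finite_induct) (auto simp: assms simp del: One_nat_def)
  have "(\<Prod>p\<in>primes_le x. f p + 1) = (\<Sum>T\<in>Pow (primes_le x). (\<Prod>p\<in>T. f p))"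
    by (subst prod_add) auto
  also have "\<dots> = (\<Sum>T\<in>Pow (primes_le x). f (\<Prod>T))"
    using finite_subset[OF _ finite_primes_le] by (intro sum.cong) (auto simp: f)
  finally show ?thesis by (simp add: add.commute)
qed

lemma prime_factors_prod_primes:
  assumes "finite T" "\<And>p. p \<in> T \<Longrightarrow> prime (p::nat)"
  shows "prime_factors (\<Prod>T) = T"
proof -
  have "prime_factorization (\<Prod>T) = mset_set T"
    using prime_factorization_prod_mset_primes[of "mset_set T"] assms by (simp add: prod_unfold_prod_mset)
  then show ?thesis using assms by simp
qed

lemma prod_prime_factors_squarefree:
  assumes "squarefree (n::nat)"
  shows "\<Prod>(prime_factors n) = n"
proof -
  have n: "n > 0" using assms by (intro gr0I) auto
  then have "n = (\<Prod>p\<in>prime_factors n. p ^ multiplicity p n)" by (rule prime_factorization_nat)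
  also have "\<dots> = \<Prod>(prime_factors n)"
    using assms n by (intro prod.cong) (auto simp: squarefree_factorial_semiring')
  finally show ?thesis ..
qed

lemma ln_one_plus_ge:
  fixes x :: real
  assumes "x \<ge> 0"
  shows "x - x ^ 2 / 2 \<le> ln (1 + x)"
proof -
  have "ln (1 + 0) - (0 - 0 ^ 2 / 2) \<le> ln (1 + x) - (x - x ^ 2 / 2)"
  proof (rule DERIV_nonneg_imp_nondecreasing[OF assms])
    fix t :: real assume t: "0 \<le> t" "t \<le> x"
    have "((\<lambda>x. ln (1 + x) - (x - x ^ 2 / 2)) has_real_derivative (1 / (1 + t) - (1 - t))) (at t)"
      using t by (auto intro!: derivative_eq_intros)
    moreover have "1 / (1 + t) - (1 - t) \<ge> 0"
      using t by (simp add: field_simps)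
    ultimately show "\<exists>y. ((\<lambda>x. ln (1 + x) - (x - x ^ 2 / 2)) has_real_derivative y) (at t) \<and> 0 \<le> y"
      by blast
  qed
  then show ?thesis by simp
qed

text \<open>Comparison with an integral in telescoping form: each term is at most a difference of
  consecutive values of \<open>n powr (- \<sigma>) / \<sigma>\<close>.\<close>

lemma sum_powr_le:
  fixes \<sigma> :: real
  assumes "\<sigma> > 0"
  shows "(\<Sum>n\<in>{1..M}. real n powr (- \<sigma> - 1)) \<le> 1 + 1 / \<sigma>"
proof -
  have step: "real (Suc n) powr (- \<sigma> - 1) \<le> (real n powr (- \<sigma>) - real (Suc n) powr (- \<sigma>)) / \<sigma>" if "n > 0" for n
  proof -
    have n: "real n > 0" using that by simp
    have "1 + \<sigma> / real (Suc n) \<le> 1 + \<sigma> * ln (real (Suc n) / real n)"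
    proof -
      have "ln (real n / real (Suc n)) \<le> real n / real (Suc n) - 1"
        using n by (intro ln_le_minus_one) simp
      also have "\<dots> = - (1 / real (Suc n))" by (simp add: field_simps)
      finally have "1 / real (Suc n) \<le> ln (real (Suc n) / real n)"
        using n by (simp add: ln_div)
      then have "\<sigma> * (1 / real (Suc n)) \<le> \<sigma> * ln (real (Suc n) / real n)"
        using assms by (intro mult_left_mono) auto
      then show ?thesis by simp
    qed
    also have "\<dots> \<le> exp (\<sigma> * ln (real (Suc n) / real n))" by (rule exp_ge_add_one_self)
    also have "\<dots> = real (Suc n) powr \<sigma> / real n powr \<sigma>"
      using n by (simp add: powr_def ln_div right_diff_distrib exp_diff)
    finally have "real (Suc n) powr (- \<sigma>) * (1 + \<sigma> / real (Suc n)) \<le> real (Suc n) powr (- \<sigma>) * (real (Suc n) powr \<sigma> / real n powr \<sigma>)"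
      by (intro mult_left_mono) auto
    also have "\<dots> = real n powr (- \<sigma>)"
      using n by (simp add: powr_minus field_simps)
    finally have "real (Suc n) powr (- \<sigma>) + \<sigma> * (real (Suc n) powr (- \<sigma>) / real (Suc n)) \<le> real n powr (- \<sigma>)"
      by (simp add: algebra_simps)
    moreover have "real (Suc n) powr (- \<sigma> - 1) = real (Suc n) powr (- \<sigma>) / real (Suc n)"
      using powr_diff[of "real (Suc n)" "- \<sigma>" 1] by simp
    ultimately have "real (Suc n) powr (- \<sigma>) + \<sigma> * real (Suc n) powr (- \<sigma> - 1) \<le> real n powr (- \<sigma>)"
      by (simp only:)
    then have "\<sigma> * real (Suc n) powr (- \<sigma> - 1) \<le> real n powr (- \<sigma>) - real (Suc n) powr (- \<sigma>)"
      by linarith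
    then show ?thesis using assms by (simp add: pos_le_divide_eq mult.commute)
  qed
  have "(\<Sum>n\<in>{1..Suc M}. real n powr (- \<sigma> - 1)) \<le> 1 + (1 - real (Suc M) powr (- \<sigma>)) / \<sigma>" for M
  proof (induction M)
    case (Suc M)
    have "(\<Sum>n\<in>{1..Suc (Suc M)}. real n powr (- \<sigma> - 1))
       \<le> 1 + (1 - real (Suc M) powr (- \<sigma>)) / \<sigma> + (real (Suc M) powr (- \<sigma>) - real (Suc (Suc M)) powr (- \<sigma>)) / \<sigma>"
      using Suc.IH step[of "Suc M"] by simp
    then show ?case by (simp add: diff_divide_distrib)
  qed simp
  moreover have "(1 - real (Suc M) powr (- \<sigma>)) / \<sigma> \<le> 1 / \<sigma>" for M
    using assms by (intro divide_right_mono) auto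
  ultimately have "(\<Sum>n\<in>{1..Suc M}. real n powr (- \<sigma> - 1)) \<le> 1 + 1 / \<sigma>" for M
    by (meson add_left_mono order.trans)
  then show ?thesis using assms by (cases M) auto
qed

text \<open>The term 1/4 is kept; from 3 on, \<open>1 / n ^ 2\<close> is at most
  \<open>1 / (n - 1) - 1 / n\<close>, which telescopes to at most 1/2.\<close>

lemma sum_inverse_squares_le: "(\<Sum>n\<in>{2..M}. 1 / real n ^ 2) \<le> 3 / 4"
proof -
  have "(\<Sum>n\<in>{2..M + 2}. 1 / real n ^ 2) \<le> 3 / 4 - 1 / real (M + 2)" for M
  proof (induction M)
    case (Suc M)
    have "1 / real (M + 3) ^ 2 \<le> 1 / real (M + 2) - 1 / real (M + 3)"
    proof -
      have "1 / (real M + 3) ^ 2 \<le> 1 / ((real M + 2) * (real M + 3))"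
        unfolding power2_eq_square by (intro divide_left_mono mult_right_mono mult_pos_pos) auto
      also have "\<dots> = 1 / (real M + 2) - 1 / (real M + 3)"
        by (simp add: field_simps)
      finally show ?thesis by (simp add: add.commute)
    qed
    moreover have "{2..Suc M + 2} = insert (M + 3) {2..M + 2}" by auto
    ultimately show ?case using Suc.IH by (simp add: algebra_simps)
  qed (simp add: power2_eq_square)
  moreover have "0 \<le> 1 / real (M + 2)" for M by simp
  ultimately have *: "(\<Sum>n\<in>{2..M + 2}. 1 / real n ^ 2) \<le> 3 / 4" for M
    by (smt (verit))
  show ?thesis
  proof (cases "M \<ge> 2")
    case True
    then have "M = M - 2 + 2" by simp
    then show ?thesis using *[of "M - 2"] by metis
  qed auto
qed

text \<open>
  Rankin's trick with the exponent \<open>1 + \<sigma>\<close>, \<open>\<sigma> = 1 / ln x\<close>: the sum of the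
  \<open>p powr (- 1 - \<sigma>)\<close> is bounded by the logarithm of the Euler product, and the difference to the
  sum of the \<open>1 / p\<close> by \<open>\<sigma>\<close> times the sum of the \<open>ln p / p\<close>.
\<close>

lemma prime_harm_upper:
  assumes "x \<ge> 2"
  shows "prime_harm x \<le> ln (1 + ln (real x)) + 5 / 4 * (1 + ln 4 / ln (real x)) + 3 / 8"
proof -
  define \<sigma> where "\<sigma> = 1 / ln (real x)"
  have lnx: "ln (real x) > 0" and \<sigma>: "\<sigma> > 0" using assms by (auto simp: \<sigma>_def)
  define f where "f n = real n powr (- \<sigma> - 1)" for n :: nat
  let ?P = "primes_le x"
  have pg: "real p \<ge> 2" if "p \<in> ?P" for p
    using that by (auto dest: prime_ge_2_nat)
  have 1: "prime_harm x \<le> (\<Sum>p\<in>?P. f p) + \<sigma> * (\<Sum>p\<in>?P. ln (real p) / real p)"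
    unfolding prime_harm_def sum_distrib_left sum.distrib[symmetric]
  proof (rule sum_mono)
    fix p assume "p \<in> ?P"
    then have p: "real p > 0" using pg[of p] by simp
    have "1 - \<sigma> * ln (real p) \<le> real p powr (- \<sigma>)"
      using exp_ge_add_one_self[of "- \<sigma> * ln (real p)"] p by (simp add: powr_def)
    then have "(1 - \<sigma> * ln (real p)) / real p \<le> real p powr (- \<sigma>) / real p"
      using p by (intro divide_right_mono) auto
    moreover have "f p = real p powr (- \<sigma>) / real p"
      using powr_diff[of "real p" "- \<sigma>" 1] p by (simp add: f_def)
    ultimately show "1 / real p \<le> f p + \<sigma> * (ln (real p) / real p)"
      by (simp add: diff_divide_distrib)
  qed
  have "\<sigma> * (\<Sum>p\<in>?P. ln (real p) / real p) \<le> \<sigma> * (5 / 4 * ln (real (4 * x)))"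
    using \<sigma> assms by (intro mult_left_mono sum_ln_over_prime_le) auto
  also have "\<dots> = 5 / 4 * (1 + ln 4 / ln (real x))"
    using lnx assms by (simp add: \<sigma>_def ln_mult field_simps)
  finally have 2: "\<sigma> * (\<Sum>p\<in>?P. ln (real p) / real p) \<le> 5 / 4 * (1 + ln 4 / ln (real x))" .
  have f0: "f p > 0" "f p \<le> 1 / real p" if "p \<in> ?P" for p
  proof -
    have "real p powr (- \<sigma> - 1) \<le> real p powr (- 1)"
      using pg[OF that] \<sigma> by (intro powr_mono) auto
    then show "f p > 0" "f p \<le> 1 / real p"
      using pg[OF that] by (auto simp: f_def powr_minus divide_simps)
  qed
  \<comment> \<open>Different sets of primes have different products, so the expanded product is
    part of the sum of \<open>f n\<close> over all positive \<open>n\<close> up to the largest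
    product.\<close>
  have "(\<Prod>p\<in>?P. 1 + f p) = (\<Sum>T\<in>Pow ?P. f (\<Prod>T))"
    by (rule prod_1_plus_primes) (auto simp: f_def powr_mult)
  also have "\<dots> = sum f (Prod ` Pow ?P)"
  proof (subst sum.reindex)
    show "inj_on Prod (Pow ?P)"
    proof (rule inj_on_inverseI)
      fix T assume "T \<in> Pow ?P"
      then show "prime_factors (\<Prod>T) = T"
        using finite_subset[OF _ finite_primes_le] by (intro prime_factors_prod_primes) auto
    qed
  qed simp
  also have "\<dots> \<le> sum f {1..Max (Prod ` Pow ?P)}"
  proof (rule sum_mono2)
    show "Prod ` Pow ?P \<subseteq> {1..Max (Prod ` Pow ?P)}"
    proof
      fix n assume n: "n \<in> Prod ` Pow ?P"
      then have "n > 0" by (auto intro!: prod_pos simp: prime_gt_0_nat subset_iff)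
      then show "n \<in> {1..Max (Prod ` Pow ?P)}" using n by (auto intro!: Max_ge)
    qed
  qed (auto simp: f_def)
  also have "\<dots> \<le> 1 + 1 / \<sigma>"
    unfolding f_def by (rule sum_powr_le[OF \<sigma>])
  also have "\<dots> = 1 + ln (real x)" by (simp add: \<sigma>_def)
  finally have "(\<Prod>p\<in>?P. 1 + f p) \<le> 1 + ln (real x)" .
  moreover have "(\<Prod>p\<in>?P. 1 + f p) > 0" using f0 by (auto intro!: prod_pos add_pos_pos)
  ultimately have "ln (\<Prod>p\<in>?P. 1 + f p) \<le> ln (1 + ln (real x))" by simp
  moreover have "ln (\<Prod>p\<in>?P. 1 + f p) = (\<Sum>p\<in>?P. ln (1 + f p))"
  proof (rule ln_prod)
    fix p assume "p \<in> ?P"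
    then show "1 + f p \<noteq> 0" using f0(1)[of p] by linarith
  qed (rule finite_primes_le)
  \<comment> \<open>The quadratic term of the logarithm loses at most half of the sum of the
    \<open>1 / p ^ 2\<close>, hence half of 3/4.\<close>
  moreover have "(\<Sum>p\<in>?P. f p) - 3 / 8 \<le> (\<Sum>p\<in>?P. ln (1 + f p))"
  proof -
    have "(\<Sum>p\<in>?P. 1 / real p ^ 2) \<le> (\<Sum>n\<in>{2..x}. 1 / real n ^ 2)"
      by (intro sum_mono2) (auto dest: prime_ge_2_nat)
    also have "\<dots> \<le> 3 / 4" by (rule sum_inverse_squares_le)
    finally have "(\<Sum>p\<in>?P. 1 / real p ^ 2) \<le> 3 / 4" .
    moreover have "(\<Sum>p\<in>?P. f p - 1 / 2 * (1 / real p ^ 2)) \<le> (\<Sum>p\<in>?P. ln (1 + f p))"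
    proof (rule sum_mono)
      fix p assume p: "p \<in> ?P"
      have "1 / real p \<le> 1" using pg[OF p] by simp
      then have "f p \<le> 1" using f0[OF p] by linarith
      have "f p - f p ^ 2 / 2 \<le> ln (1 + f p)"
        using f0(1)[OF p] by (intro ln_one_plus_ge) simp
      moreover have "f p ^ 2 \<le> 1 / real p ^ 2"
        using power_mono[OF f0(2)[OF p], of 2] f0(1)[OF p] by (simp add: power_divide)
      ultimately show "f p - 1 / 2 * (1 / real p ^ 2) \<le> ln (1 + f p)" by linarith
    qed
    ultimately show ?thesis
      unfolding sum_subtractf sum_distrib_left[symmetric] by linarith
  qed
  ultimately show ?thesis using 1 2 by linarith
qed

text \<open>Every \<open>n \<le> x\<close> is a square times a squarefree number composed of primes \<open>p \<le> x\<close>.\<close>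

lemma prime_harm_lower:
  assumes "x \<ge> 2"
  shows "ln (ln (real x)) - ln (7 / 4) \<le> prime_harm x"
proof -
  let ?P = "primes_le x"
  have "ln (real x) \<le> ln (real x + 1)" using assms by simp
  also have "\<dots> \<le> harm x" by (rule ln_le_harm)
  also have "harm x = (\<Sum>n\<in>{1..x}. 1 / real n)"
    by (simp add: harm_def inverse_eq_divide)
  also have "\<dots> \<le> (\<Sum>(m, T)\<in>{1..x} \<times> Pow ?P. 1 / real m ^ 2 * (1 / real (\<Prod>T)))"
  proof -
    \<comment> \<open>The square part and the primes of the squarefree part determine
      \<open>n\<close>, so every \<open>1 / n\<close> is a separate term of the larger sum.\<close>
    let ?h = "\<lambda>n. (square_part n, prime_factors (squarefree_part n))"
    have dec: "n = \<Prod>(prime_factors (squarefree_part n)) * square_part n ^ 2" for n :: nat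
    proof -
      have "\<Prod>(prime_factors (squarefree_part n)) = squarefree_part n"
        by (rule prod_prime_factors_squarefree) simp
      then show ?thesis using squarefree_decompose[of n] by simp
    qed
    have inj: "inj_on ?h {1..x}"
      by (rule inj_onI) (metis dec prod.inject)
    have "(\<Sum>n\<in>{1..x}. 1 / real n) = (\<Sum>n\<in>{1..x}. (case ?h n of (m, T) \<Rightarrow> 1 / real m ^ 2 * (1 / real (\<Prod>T))))"
    proof (rule sum.cong)
      fix n
      have "real n = real (\<Prod>(prime_factors (squarefree_part n))) * real (square_part n) ^ 2"
        by (subst dec[of n]) (simp only: of_nat_mult of_nat_power)
      then show "1 / real n = (case ?h n of (m, T) \<Rightarrow> 1 / real m ^ 2 * (1 / real (\<Prod>T)))"
        by simp
    qed simp
    also have "\<dots> = (\<Sum>(m, T)\<in>?h ` {1..x}. 1 / real m ^ 2 * (1 / real (\<Prod>T)))"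
      by (subst sum.reindex[OF inj]) simp
    also have "\<dots> \<le> (\<Sum>(m, T)\<in>{1..x} \<times> Pow ?P. 1 / real m ^ 2 * (1 / real (\<Prod>T)))"
    proof (rule sum_mono2)
      show "?h ` {1..x} \<subseteq> {1..x} \<times> Pow ?P"
      proof
        fix y assume "y \<in> ?h ` {1..x}"
        then obtain n where n: "n \<in> {1..x}" "y = ?h n" by blast
        have "square_part n dvd n" "squarefree_part n dvd n"
          using squarefree_decompose[of n] by (metis dvd_triv_left dvd_triv_right power2_eq_square dvd_mult_left dvd_mult)+
        then have "square_part n \<le> n" "squarefree_part n \<le> n" "square_part n > 0" "squarefree_part n > 0"
          using n(1) by (auto intro: dvd_imp_le gr0I)
        then show "y \<in> {1..x} \<times> Pow ?P"
          using n by (auto simp: in_prime_factors_iff Suc_le_eq dest!: dvd_imp_le)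
      qed
    qed (auto intro!: mult_nonneg_nonneg prod_nonneg)
    finally show ?thesis .
  qed
  also have "\<dots> = (\<Sum>m\<in>{1..x}. 1 / real m ^ 2) * (\<Sum>T\<in>Pow ?P. 1 / real (\<Prod>T))"
    by (simp only: sum_product sum.cartesian_product)
  also have "(\<Sum>T\<in>Pow ?P. 1 / real (\<Prod>T)) = (\<Prod>p\<in>?P. 1 + 1 / real p)"
    by (rule prod_1_plus_primes[symmetric, of "\<lambda>n. 1 / real n"]) auto
  also have "(\<Sum>m\<in>{1..x}. 1 / real m ^ 2) * (\<Prod>p\<in>?P. 1 + 1 / real p) \<le> 7 / 4 * exp (prime_harm x)"
  proof (rule mult_mono)
    have "{1..x} = insert 1 {2..x}" using assms by auto
    then show "(\<Sum>m\<in>{1..x}. 1 / real m ^ 2) \<le> 7 / 4"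
      using sum_inverse_squares_le[of x] by simp
    show "(\<Prod>p\<in>?P. 1 + 1 / real p) \<le> exp (prime_harm x)"
      unfolding prime_harm_def by (subst exp_sum) (auto intro!: prod_mono add_nonneg_nonneg)
  qed (auto intro!: prod_nonneg)
  finally have "ln (ln (real x)) \<le> ln (7 / 4 * exp (prime_harm x))"
    using assms by (subst ln_le_cancel_iff) auto
  also have "\<dots> = ln (7 / 4) + prime_harm x" by (subst ln_mult) simp_all
  finally show ?thesis by simp
qed

subsection \<open>The mean of the number of prime factors\<close>

lemma big_Omega_mult: "a > 0 \<Longrightarrow> b > 0 \<Longrightarrow> \<Omega> (a * b) = \<Omega> a + \<Omega> b"
  by (simp add: big_Omega_def prime_factorization_mult)

text \<open>A prime yields one pair for each exponent up to its multiplicity. In this form the sum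
  over \<open>n\<close> can be exchanged with the sum over prime powers.\<close>

lemma big_Omega_eq_card:
  assumes "n > 0"
  shows "\<Omega> n = card {(p, a). prime p \<and> 1 \<le> a \<and> p ^ a dvd n}"
proof -
  have "{(p, a). prime p \<and> 1 \<le> a \<and> p ^ a dvd n} = (SIGMA p:prime_factors n. {1..multiplicity p n})"
  proof (intro Set.set_eqI, clarify)
    fix p a
    have "prime p \<and> 1 \<le> a \<and> p ^ a dvd n \<longleftrightarrow> prime p \<and> 1 \<le> a \<and> a \<le> multiplicity p n"
    proof (cases "prime p")
      case True
      then have "\<not> is_unit p" using not_prime_unit by blast
      then show ?thesis using assms by (simp add: power_dvd_iff_le_multiplicity)
    qed simp
    then show "(p, a) \<in> {(p, a). prime p \<and> 1 \<le> a \<and> p ^ a dvd n} \<longleftrightarrow>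
        (p, a) \<in> (SIGMA p:prime_factors n. {1..multiplicity p n})"
      using assms by (auto simp: prime_factors_multiplicity)
  qed
  moreover have "size (prime_factorization n) = (\<Sum>p\<in>prime_factors n. multiplicity p n)"
    unfolding size_multiset_overloaded_eq
    by (intro sum.cong) (auto simp: count_prime_factorization in_prime_factors_iff)
  ultimately show ?thesis by (simp add: big_Omega_def)
qed

lemma prime_power_dvd_bound:
  fixes n :: nat
  assumes "prime p" "p ^ a dvd n" "0 < n" "n < 2 ^ L"
  shows "a \<le> L"
proof -
  have "(2::nat) ^ a \<le> p ^ a" using assms prime_ge_2_nat by (intro power_mono) auto
  also have "\<dots> \<le> n" using assms by (intro dvd_imp_le)
  also have "\<dots> < 2 ^ L" by (rule assms(4))
  finally have "a < L" by simp
  then show ?thesis by simp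
qed

lemma finite_Omega_pairs:
  assumes "0 < n"
  shows "finite {(p, a). prime p \<and> 1 \<le> a \<and> p ^ a dvd (n::nat)}"
proof (rule finite_subset)
  have "p \<le> n \<and> a \<le> n" if p: "prime p" "1 \<le> a" "p ^ a dvd n" for p a
  proof -
    have "p dvd n" using p by (meson dvd_power dvd_trans less_le_trans zero_less_one)
    moreover have "a \<le> n" using prime_power_dvd_bound[OF p(1,3) assms, of n] by simp
    ultimately show ?thesis using assms by (auto dest: dvd_imp_le)
  qed
  then show "{(p, a). prime p \<and> 1 \<le> a \<and> p ^ a dvd n} \<subseteq> {..n} \<times> {..n}" by auto
qed simp

text \<open>If every pair \<open>n\<close>, \<open>N - n\<close> had at least 22 prime factors
  together, then by reflection twice the sum over \<open>S\<close> would be at least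
  \<open>22 * card S\<close>.\<close>

lemma exists_of_mean:
  assumes S: "S \<subseteq> {1..<N}" "\<And>n. n \<in> S \<Longrightarrow> N - n \<in> S"
    and less: "real (\<Sum>n\<in>S. \<Omega> n) < 11 * real (card S)"
  shows "\<exists>a b. a > 0 \<and> b > 0 \<and> N = a + b \<and> \<Omega> (a * b) \<le> 21"
proof (rule ccontr)
  assume no: "\<nexists>a b. a > 0 \<and> b > 0 \<and> N = a + b \<and> \<Omega> (a * b) \<le> 21"
  have "22 \<le> \<Omega> n + \<Omega> (N - n)" if "n \<in> S" for n
  proof (rule ccontr)
    assume "\<not> ?thesis"
    then have "\<Omega> (n * (N - n)) \<le> 21" "n > 0" "N - n > 0" "N = n + (N - n)"
      using that S(1) by (auto simp: big_Omega_mult)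
    then show False using no by blast
  qed
  then have "(\<Sum>n\<in>S. 22) \<le> (\<Sum>n\<in>S. \<Omega> n + \<Omega> (N - n))" by (intro sum_mono)
  also have "\<dots> = (\<Sum>n\<in>S. \<Omega> n) + (\<Sum>n\<in>S. \<Omega> (N - n))" by (rule sum.distrib)
  also have "(\<Sum>n\<in>S. \<Omega> (N - n)) = (\<Sum>n\<in>S. \<Omega> n)"
  proof (rule sum.reindex_bij_witness[of _ "\<lambda>n. N - n" "\<lambda>n. N - n"])
    fix n assume "n \<in> S"
    then show "N - (N - n) = n" "N - n \<in> S" "N - (N - n) = n" "N - n \<in> S" using S by auto
  qed auto
  finally have "22 * card S \<le> 2 * (\<Sum>n\<in>S. \<Omega> n)" by simp
  then have "11 * card S \<le> (\<Sum>n\<in>S. \<Omega> n)" by simp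
  then have "real (11 * card S) \<le> real (\<Sum>n\<in>S. \<Omega> n)" by (simp only: of_nat_le_iff)
  then show False using less by simp
qed

text \<open>The geometric series is at most \<open>1 / (p - 1)\<close>; the split isolates
  \<open>1 / p\<close> from a remainder whose sum over all primes converges.\<close>

lemma sum_inverse_powers_le:
  assumes "p \<ge> (2::nat)"
  shows "(\<Sum>a\<in>{1..L}. 1 / real p ^ a) \<le> 1 / real p + 1 / (real p * (real p - 1))"
proof -
  have p: "real p \<ge> 2" using assms by simp
  have "(\<Sum>a\<in>{1..L}. 1 / real p ^ a) = (1 - 1 / real p ^ L) / (real p - 1)"
  proof (induction L)
    case (Suc L)
    have "(1 - 1 / real p ^ Suc L) / (real p - 1) = (1 - 1 / real p ^ L) / (real p - 1) + 1 / real p ^ Suc L"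
      using p by (simp add: divide_simps) (simp add: algebra_simps)
    then show ?case using Suc by simp
  qed simp
  also have "\<dots> \<le> 1 / (real p - 1)"
    using p by (intro divide_right_mono) auto
  also have "\<dots> = 1 / real p + 1 / (real p * (real p - 1))"
    using p by (simp add: field_simps)
  finally show ?thesis .
qed

lemma sum_inverse_consecutive_le:
  assumes "finite A" "w \<ge> 1" "\<And>p. p \<in> A \<Longrightarrow> w < p"
  shows "(\<Sum>p\<in>A. 1 / (real p * (real p - 1))) \<le> 1 / real w"
proof -
  have tele: "(\<Sum>p\<in>{w<..w + M}. 1 / (real p * (real p - 1))) = 1 / real w - 1 / real (w + M)" for M
  proof (induction M)
    case (Suc M)
    have "{w<..w + Suc M} = insert (w + Suc M) {w<..w + M}" by auto
    then have "(\<Sum>p\<in>{w<..w + Suc M}. 1 / (real p * (real p - 1)))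
        = 1 / (real (w + Suc M) * (real (w + Suc M) - 1)) + (1 / real w - 1 / real (w + M))"
      using Suc by simp
    also have "1 / (real (w + Suc M) * (real (w + Suc M) - 1)) = 1 / real (w + M) - 1 / real (w + Suc M)"
      using assms(2) by (simp add: divide_simps)
    finally show ?case by simp
  qed simp
  obtain M where M: "A \<subseteq> {..M}" using assms(1) finite_nat_iff_bounded_le by blast
  have "(\<Sum>p\<in>A. 1 / (real p * (real p - 1))) \<le> (\<Sum>p\<in>{w<..w + M}. 1 / (real p * (real p - 1)))"
    using M assms by (intro sum_mono2) auto
  also have "\<dots> \<le> 1 / real w" unfolding tele by simp
  finally show ?thesis .
qed

lemma card_dvd_less:
  assumes "m > 0"
  shows "real (card {n \<in> {1..<N}. m dvd n}) \<le> real (N - 1) / real m"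
proof -
  have "{1..<N} = {1..N - 1}" by auto
  then have "card {n \<in> {1..<N}. m dvd n} = (N - 1) div m" using card_multiples[OF assms, of "N - 1"] by simp
  then show ?thesis by (simp add: of_nat_div_le_of_nat)
qed

lemma sum_card_swap:
  assumes "finite S" "finite R"
  shows "(\<Sum>n\<in>S. real (card {x \<in> R. Q n x})) = (\<Sum>x\<in>R. real (card {n \<in> S. Q n x}))"
  using sum.swap_restrict[OF assms, of "\<lambda>_ _. 1::real" Q] by simp

text \<open>Cutting \<open>x\<close> into \<open>n\<close> parts makes the quadratic Taylor bound
  sharp enough for numerical checks.\<close>

lemma exp_lower_approx: "(1 + x / real n + (x / real n) ^ 2 / 2) ^ n \<le> exp x" if "x \<ge> 0" "n > 0" for x :: real
proof -
  have "(1 + x / real n + (x / real n) ^ 2 / 2) ^ n \<le> exp (x / real n) ^ n"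
    using that by (intro power_mono exp_lower_Taylor_quadratic) auto
  also have "\<dots> = exp x" using that by (simp add: exp_of_nat_mult[symmetric])
  finally show ?thesis .
qed

lemma prime_harm_power_2:
  assumes "L \<ge> 1"
  shows "prime_harm (2 ^ L) \<le> ln (1 + real L * ln 2) + 5 / 4 * (1 + 2 / real L) + 3 / 8"
proof -
  have "2 ^ L \<ge> (2::nat)" using assms self_le_power[of "2::nat" L] by simp
  moreover have "ln (real (2 ^ L)) = real L * ln 2" by (simp add: ln_realpow)
  moreover have "ln 4 = 2 * ln (2::real)" using ln_realpow[of 2 2] by simp
  ultimately show ?thesis using prime_harm_upper[of "2 ^ L"] by (simp del: of_nat_power)
qed

text \<open>All \<open>n\<close> below \<open>N\<close> are averaged. At most
  \<open>(N - 1) / p ^ a\<close> of these \<open>N - 1\<close> numbers are multiples of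
  \<open>p ^ a\<close>, so no error term arises. The mean is at most the sum of the
  \<open>1 / p\<close> plus 1 for the higher powers, whence the bound 10.\<close>

lemma small_case:
  assumes "N \<ge> 2" "N < 2 ^ L" "prime_harm (2 ^ L) < 10"
  shows "\<exists>a b. a > 0 \<and> b > 0 \<and> N = a + b \<and> \<Omega> (a * b) \<le> 21"
proof (rule exists_of_mean)
  let ?x = "2 ^ L :: nat"
  let ?R = "primes_le ?x \<times> {1..L}"
  have "real (\<Sum>n\<in>{1..<N}. \<Omega> n) = (\<Sum>n\<in>{1..<N}. real (card {x \<in> ?R. fst x ^ snd x dvd n}))"
    unfolding of_nat_sum
  proof (rule sum.cong)
    fix n assume n: "n \<in> {1..<N}"
    have "{(p, a). prime p \<and> 1 \<le> a \<and> p ^ a dvd n} = {x \<in> ?R. fst x ^ snd x dvd n}"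
    proof -
      have "p \<le> ?x" "a \<le> L" if "prime p" "1 \<le> a" "p ^ a dvd n" for p a
      proof -
        have "p dvd n" using that by (meson dvd_power dvd_trans less_le_trans zero_less_one)
        then show "p \<le> ?x" using n assms(2) by (auto dest!: dvd_imp_le)
        show "a \<le> L" using prime_power_dvd_bound[OF that(1,3)] n assms(2) by auto
      qed
      then show ?thesis by auto
    qed
    then show "real (\<Omega> n) = real (card {x \<in> ?R. fst x ^ snd x dvd n})"
      using n big_Omega_eq_card[of n] by (simp only: atLeastLessThan_iff) simp
  qed simp
  also have "\<dots> = (\<Sum>x\<in>?R. real (card {n \<in> {1..<N}. fst x ^ snd x dvd n}))"
    by (rule sum_card_swap) auto
  also have "\<dots> \<le> (\<Sum>x\<in>?R. real (N - 1) * (1 / real (fst x) ^ snd x))"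
  proof (rule sum_mono)
    fix x assume "x \<in> ?R"
    then have "fst x ^ snd x > 0" by (auto simp: prime_gt_0_nat)
    from card_dvd_less[OF this, of N]
    show "real (card {n \<in> {1..<N}. fst x ^ snd x dvd n}) \<le> real (N - 1) * (1 / real (fst x) ^ snd x)"
      by simp
  qed
  also have "\<dots> = real (N - 1) * (\<Sum>p\<in>primes_le ?x. \<Sum>a\<in>{1..L}. 1 / real p ^ a)"
    by (subst sum.cartesian_product) (simp add: sum_distrib_left split_beta)
  also have "\<dots> \<le> real (N - 1) * (\<Sum>p\<in>primes_le ?x. 1 / real p + 1 / (real p * (real p - 1)))"
    by (intro mult_left_mono sum_mono sum_inverse_powers_le) (auto dest: prime_ge_2_nat)
  also have "\<dots> \<le> real (N - 1) * (prime_harm ?x + 1)"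
  proof -
    have "(\<Sum>p\<in>primes_le ?x. 1 / (real p * (real p - 1))) \<le> 1 / real 1"
      by (rule sum_inverse_consecutive_le) (simp_all add: prime_gt_Suc_0_nat)
    then show ?thesis
      by (intro mult_left_mono) (auto simp: prime_harm_def sum.distrib)
  qed
  also have "\<dots> < real (N - 1) * 11"
    using assms by (intro mult_strict_left_mono) auto
  finally show "real (\<Sum>n\<in>{1..<N}. \<Omega> n) < 11 * real (card {1..<N})" by simp
qed auto

lemma prime_harm_2_4096: "prime_harm (2 ^ 4096) < 10"
proof -
  \<comment> \<open>As \<open>ln 2 <= 25 / 36\<close>, the left side is below 2846, slightly less
    than \<open>exp 8\<close>.\<close>
  have "1 + 4096 * ln 2 \<le> (1 + 8 / real 64 + (8 / real 64) ^ 2 / 2) ^ 64"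
    using ln2_le_25_over_36 by (simp add: power_divide)
  also have "\<dots> \<le> exp (8::real)" by (rule exp_lower_approx) auto
  finally have "ln (1 + real 4096 * ln 2) \<le> 8"
    using ln_mono[of "1 + 4096 * ln 2" "exp (8::real)"] by (simp add: add_pos_pos)
  moreover have "prime_harm (2 ^ 4096) \<le> ln (1 + real 4096 * ln 2) + 5 / 4 * (1 + 2 / real 4096) + 3 / 8"
    by (rule prime_harm_power_2) simp
  ultimately have "prime_harm (2 ^ 4096) \<le> 8 + 5 / 4 * (1 + 2 / real 4096) + 3 / 8"
    by (meson add_right_mono order.trans)
  also have "\<dots> < 10" by simp
  finally show ?thesis .
qed

subsection \<open>Sifting by blocks of primes\<close>

lemma ln_seven_quarters: "ln (7 / 4) \<le> (3 / 5 :: real)"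
proof -
  have "(7 / 4 :: real) \<le> exp (3 / 5)"
    using exp_lower_Taylor_quadratic[of "3 / 5 :: real"] by (simp add: power2_eq_square)
  then have "ln (7 / 4) \<le> ln (exp (3 / 5 :: real))" by (subst ln_le_cancel_iff) auto
  then show ?thesis by simp
qed

text \<open>The upper bound at \<open>2 ^ l\<close> is set against the lower bound at
  \<open>2 ^ m\<close>. The constant 39/40 is 3/8 from the former plus 3/5, which bounds
  \<open>ln (7 / 4)\<close>, from the latter.\<close>

lemma prime_harm_diff:
  assumes "l \<ge> 1" "m \<ge> 1" "1 + real l * ln 2 \<le> exp C * (real m * ln 2)"
  shows "prime_harm (2 ^ l) - prime_harm (2 ^ m) \<le> C + 5 / 4 * (1 + 2 / real l) + 39 / 40"
proof -
  have m: "real m * ln 2 > 0" using assms(2) by simp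
  have "ln (1 + real l * ln 2) \<le> ln (exp C * (real m * ln 2))"
    using assms(3) m by (intro ln_mono) (auto intro: add_pos_nonneg)
  also have "\<dots> = C + ln (real m * ln 2)" using m by (subst ln_mult) auto
  finally have 1: "ln (1 + real l * ln 2) \<le> C + ln (real m * ln 2)" .
  have "2 ^ m \<ge> (2::nat)" using assms(2) self_le_power[of "2::nat" m] by simp
  then have "ln (ln (real (2 ^ m))) - ln (7 / 4) \<le> prime_harm (2 ^ m)" by (rule prime_harm_lower)
  moreover have "ln (real (2 ^ m)) = real m * ln 2" by (simp add: ln_realpow)
  ultimately have "ln (real m * ln 2) - 3 / 5 \<le> prime_harm (2 ^ m)"
    using ln_seven_quarters by (simp del: of_nat_power)
  then show ?thesis using 1 prime_harm_power_2[OF assms(1)] by linarith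
qed

lemma sum_primes_between:
  assumes "m \<le> l"
  shows "(\<Sum>p | prime p \<and> m < p \<and> p \<le> l. 1 / real p) = prime_harm l - prime_harm m"
proof -
  have "primes_le l = primes_le m \<union> {p. prime p \<and> m < p \<and> p \<le> l}" using assms by auto
  moreover have "finite {p. prime p \<and> m < p \<and> p \<le> l}"
    by (rule finite_subset[of _ "{..l}"]) auto
  ultimately have "prime_harm l = prime_harm m + (\<Sum>p | prime p \<and> m < p \<and> p \<le> l. 1 / real p)"
    unfolding prime_harm_def by (simp only:) (rule sum.union_disjoint, auto)
  then show ?thesis by simp
qed

section \<open>Blocks of primes and truncation levels\<close>

text \<open>The upper end is the square of the lower one, so the logarithm doubles across a block
  and the sum of the \<open>1 / p\<close> over it is bounded independently of
  \<open>i\<close>.\<close>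

definition block :: "nat \<Rightarrow> nat set"
  where "block i = {p. prime p \<and> 2 ^ (4 * 2 ^ i) < p \<and> p \<le> 2 ^ (4 * 2 ^ Suc i)}"

lemma finite_block [simp]: "finite (block i)"
  unfolding block_def by (rule finite_subset[of _ "{..2 ^ (4 * 2 ^ Suc i)}"]) auto

lemma block_gt_16: "p \<in> block i \<Longrightarrow> p > 16"
proof -
  assume "p \<in> block i"
  then have "2 ^ (4 * 2 ^ i) < p" by (simp add: block_def)
  moreover have "(2::nat) ^ 4 \<le> 2 ^ (4 * 2 ^ i)" by (intro power_increasing) auto
  ultimately show ?thesis by simp
qed

lemma block_disjoint:
  assumes "i \<noteq> j"
  shows "block i \<inter> block j = {}"
proof -
  have "block i \<inter> block j = {}" if "i < j" for i j
  proof -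
    have "(2::nat) ^ Suc i \<le> 2 ^ j" using that by (intro power_increasing) auto
    then have "(2::nat) ^ (4 * 2 ^ Suc i) \<le> 2 ^ (4 * 2 ^ j)" by (intro power_increasing) auto
    moreover have "p \<le> 2 ^ (4 * 2 ^ Suc i)" "2 ^ (4 * 2 ^ j) < p" if "p \<in> block i" "p \<in> block j" for p
      using that by (simp_all only: block_def mem_Collect_eq)
    ultimately show ?thesis by (meson disjoint_iff leD le_trans)
  qed
  then show ?thesis using assms by (metis inf_commute nat_neq_iff)
qed

lemma UN_block: "(\<Union>i<k. block i) = {p. prime p \<and> 16 < p \<and> p \<le> 2 ^ (4 * 2 ^ k)}"
proof (induction k)
  case (Suc k)
  define u v :: nat where "u = 2 ^ (4 * 2 ^ k)" and "v = 2 ^ (4 * 2 ^ Suc k)"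
  have "u \<le> v" unfolding u_def v_def by (intro power_increasing) auto
  moreover have "2 ^ 4 \<le> u" unfolding u_def by (intro power_increasing) auto
  moreover have "block k = {p. prime p \<and> u < p \<and> p \<le> v}"
    unfolding block_def u_def v_def ..
  moreover have "(\<Union>i<k. block i) = {p. prime p \<and> 16 < p \<and> p \<le> u}"
    using Suc unfolding u_def .
  ultimately show ?case
    unfolding lessThan_Suc UN_insert v_def[symmetric] by auto
qed auto

text \<open>The primes of a block are odd and greater than 1, so they fill at most half of the
  range. The form \<open>1 + 2 * card (block i)\<close> is the base of the power that bounds
  \<open>cost\<close>.\<close>

lemma card_block: "1 + 2 * card (block i) \<le> 2 ^ (4 * 2 ^ Suc i)"
proof -
  define w where "w = (2::nat) ^ (4 * 2 ^ Suc i - 1)"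
  have w: "2 * w = 2 ^ (4 * 2 ^ Suc i)" "w > 0"
    by (simp_all add: w_def power_Suc[symmetric] del: power_Suc)
  have "block i \<subseteq> (\<lambda>m. 2 * m + 1) ` {1..<w}"
  proof
    fix p assume p: "p \<in> block i"
    then have "odd p" using block_gt_16[OF p] by (auto simp: block_def dest: prime_odd_nat)
    then obtain m where m: "p = 2 * m + 1" by (elim oddE)
    have "p \<le> 2 * w" using p w by (simp add: block_def)
    then show "p \<in> (\<lambda>m. 2 * m + 1) ` {1..<w}"
      using m block_gt_16[OF p] by (intro image_eqI[of _ _ m]) auto
  qed
  then have "card (block i) \<le> card ((\<lambda>m. 2 * m + 1) ` {1..<w})"
    by (rule card_mono[rotated]) simp
  also have "\<dots> \<le> w - 1" using card_image_le[of "{1..<w}" "\<lambda>m. 2 * m + 1"] by simp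
  finally show ?thesis unfolding w(1)[symmetric] using w(2) by linarith
qed

lemma dens_bounds:
  assumes "p > 16"
  shows "0 \<le> dens N p" "dens N p \<le> 2 / real p" "dens N p \<le> 1 / 8"
proof -
  show "0 \<le> dens N p" "dens N p \<le> 2 / real p"
    by (auto simp: dens_def intro!: divide_right_mono)
  moreover have "2 / real p \<le> 2 / 16" using assms by (intro divide_left_mono) auto
  ultimately show "dens N p \<le> 1 / 8" by simp
qed

text \<open>Each density is at most \<open>2 / p\<close>, and the reciprocals over a block sum to at
  most 9/10 + 25/16 + 39/40, which is below 7/2.\<close>

lemma sum_dens_block: "(\<Sum>p\<in>block i. dens N p) \<le> 7"
proof -
  define m :: nat where "m = 4 * 2 ^ i"
  have m: "m \<ge> 4" by (simp add: m_def)
  have l: "4 * 2 ^ Suc i = 2 * m" by (simp add: m_def)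
  have "(\<Sum>p\<in>block i. dens N p) \<le> (\<Sum>p\<in>block i. 2 * (1 / real p))"
    using dens_bounds(2)[OF block_gt_16] by (intro sum_mono) auto
  also have "\<dots> = 2 * (prime_harm (2 ^ (2 * m)) - prime_harm (2 ^ m))"
    unfolding sum_distrib_left[symmetric] block_def l m_def[symmetric]
    by (subst sum_primes_between) (auto intro: power_increasing)
  also have "prime_harm (2 ^ (2 * m)) - prime_harm (2 ^ m) \<le> 9 / 10 + 5 / 4 * (1 + 2 / real (2 * m)) + 39 / 40"
  proof (rule prime_harm_diff)
    \<comment> \<open>Since \<open>m * ln 2 >= 8 / 3\<close>, the summand 1 is at most 3/8 of it,
      which raises the ratio 2 to 19/8.\<close>
    have "4 * (2 / 3) \<le> real m * ln 2" using m ln2_ge_two_thirds by (intro mult_mono) auto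
    then have "1 + real (2 * m) * ln 2 \<le> 19 / 8 * (real m * ln 2)" by simp
    moreover have "19 / 8 \<le> exp (9 / 10 :: real)"
      using exp_lower_approx[of "9 / 10" 2] by (simp add: power2_eq_square)
    then have "19 / 8 * (real m * ln 2) \<le> exp (9 / 10) * (real m * ln 2)"
      by (intro mult_right_mono) auto
    ultimately show "1 + real (2 * m) * ln 2 \<le> exp (9 / 10) * (real m * ln 2)" by linarith
  qed (use m in auto)
  also have "2 / real (2 * m) \<le> 1 / 4" using m by simp
  finally show ?thesis by simp
qed

lemma exp_minus_le_one_minus:
  fixes x :: real
  assumes "0 \<le> x" "x \<le> 1 / 8"
  shows "exp (- (8 / 7 * x)) \<le> 1 - x"
proof -
  have "1 / (1 - x) = 1 + x / (1 - x)" using assms by (simp add: field_simps)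
  also have "x / (1 - x) \<le> 8 / 7 * x"
    using assms mult_left_mono[of "8 * x" 1 x] by (simp add: field_simps)
  also have "1 + 8 / 7 * x \<le> exp (8 / 7 * x)" by (rule exp_ge_add_one_self)
  finally have "1 / exp (8 / 7 * x) \<le> 1 - x" using assms by (simp add: field_simps)
  then show ?thesis by (simp add: exp_minus field_simps)
qed

text \<open>At an even level \<open>bonf\<close> is at least the full product of the
  \<open>1 - dens N p\<close>, and this is at least \<open>exp (- (8 / 7 * 7))\<close>.\<close>

lemma bonf_block_ge:
  assumes "even b"
  shows "exp (- 8) \<le> bonf b (dens N) (block i)"
proof -
  have g: "0 \<le> dens N p" "dens N p \<le> 1 / 8" if "p \<in> block i" for p
    using dens_bounds[OF block_gt_16[OF that]] by auto
  have "exp (- 8) \<le> exp (- (8 / 7 * (\<Sum>p\<in>block i. dens N p)))"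
    using sum_dens_block[of N i] by simp
  also have "\<dots> = (\<Prod>p\<in>block i. exp (- (8 / 7 * dens N p)))"
    by (subst exp_sum[symmetric]) (simp_all add: sum_negf sum_distrib_left)
  also have "\<dots> \<le> (\<Prod>p\<in>block i. 1 - dens N p)"
    using g exp_minus_le_one_minus by (intro prod_mono conjI) simp_all
  also have "\<dots> \<le> bonf b (dens N) (block i)"
    using bonferroni[of "block i" "dens N" b] g assms by fastforce
  finally show ?thesis .
qed

text \<open>Raising the index \<open>n\<close> by two multiplies by
  \<open>49 / ((n + 1) * (n + 2))\<close>, at most \<open>49 / 28 ^ 2 = 1 / 16\<close>.\<close>

lemma power_over_fact_le: "7 ^ (27 + 2 * j) / fact (27 + 2 * j) \<le> (7 ^ 27 / fact 27 :: real) * (1 / 16) ^ j"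
proof (induction j)
  case (Suc j)
  define n where "n = 27 + 2 * j"
  have n: "27 + 2 * Suc j = Suc (Suc n)" by (simp add: n_def)
  have "7 ^ Suc (Suc n) / fact (Suc (Suc n)) = (7 ^ n / fact n :: real) * (49 / ((real n + 2) * (real n + 1)))"
    by (simp add: field_simps)
  also have "\<dots> \<le> (7 ^ n / fact n :: real) * (1 / 16)"
  proof (intro mult_left_mono)
    have "28 * 28 \<le> (real n + 2) * (real n + 1)" by (intro mult_mono) (auto simp: n_def)
    then show "49 / ((real n + 2) * (real n + 1)) \<le> 1 / 16" by (simp add: field_simps)
  qed auto
  also have "\<dots> \<le> (7 ^ 27 / fact 27) * (1 / 16) ^ j * (1 / 16)"
    using Suc.IH by (intro mult_right_mono) (auto simp: n_def)
  finally show ?case unfolding n by (simp only: power_Suc mult_ac)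
qed simp

lemma exp_8_le: "exp 8 \<le> (3000 :: real)"
proof -
  have "exp 8 = (exp 1 :: real) ^ 8" by (simp add: exp_of_nat_mult[symmetric])
  also have "\<dots> \<le> (272 / 100) ^ 8" using e_less_272 by (intro power_mono) auto
  also have "\<dots> \<le> 3000" by (simp add: power_divide)
  finally show ?thesis .
qed

text \<open>The numerator is at most \<open>7 ^ r / fact r\<close> with
  \<open>r = 27 + 2 * j\<close>, the denominator at least \<open>exp (- 8)\<close>. The base level
  26 is high enough for \<open>3000 * 7 ^ 27 / fact 27\<close> to fall below 3/160.\<close>

lemma esym_bonf_ratio:
  "esym (Suc (26 + 2 * j)) (dens N) (block i) / bonf (26 + 2 * j) (dens N) (block i) \<le> 3 / 160 * (1 / 16) ^ j"
proof -
  have g: "0 \<le> dens N p" if "p \<in> block i" for p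
    using dens_bounds[OF block_gt_16[OF that]] by auto
  have e: "exp (- 8) \<le> bonf (26 + 2 * j) (dens N) (block i)" by (rule bonf_block_ge) simp
  have "esym (27 + 2 * j) (dens N) (block i) \<le> (\<Sum>p\<in>block i. dens N p) ^ (27 + 2 * j) / fact (27 + 2 * j)"
    using g by (intro esym_le) auto
  also have "\<dots> \<le> 7 ^ (27 + 2 * j) / fact (27 + 2 * j)"
    using g sum_dens_block by (intro divide_right_mono power_mono sum_nonneg) auto
  also have "\<dots> \<le> 7 ^ 27 / fact 27 * (1 / 16) ^ j" by (rule power_over_fact_le)
  finally have "esym (27 + 2 * j) (dens N) (block i) / bonf (26 + 2 * j) (dens N) (block i)
      \<le> (7 ^ 27 / fact 27 * (1 / 16) ^ j) / exp (- 8)"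
    using e less_le_trans[OF exp_gt_zero e] by (intro frac_le) auto
  also have "\<dots> = 7 ^ 27 / fact 27 * exp 8 * (1 / 16) ^ j"
    by (simp only: exp_minus divide_inverse inverse_inverse_eq mult_ac)
  also have "\<dots> \<le> 3 / 160 * (1 / 16) ^ j"
  proof (intro mult_right_mono)
    have "7 ^ 27 / fact 27 * exp 8 \<le> (7 ^ 27 / fact 27 * 3000 :: real)"
      using exp_8_le by (intro mult_left_mono) auto
    also have "\<dots> \<le> 3 / 160" by (simp add: fact_numeral)
    finally show "7 ^ 27 / fact 27 * exp 8 \<le> (3 / 160 :: real)" .
  qed auto
  finally show ?thesis by simp
qed

text \<open>After discarding the factorials and inserting binomial coefficients, the sum over subset
  sizes becomes a binomial expansion.\<close>

lemma cost_le:
  assumes "finite P"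
  shows "cost b P \<le> (1 + 2 * real (card P)) ^ Suc b"
proof -
  have "cost b P = (\<Sum>i\<le>Suc b. esym i (\<lambda>_. 2) P)"
    unfolding cost_def esym_def msum_def
    by (subst sum.swap, intro sum.cong)
      (auto simp: of_bool_def sum_distrib_right[symmetric] sum.delta simp del: sum.atMost_Suc)
  also have "\<dots> \<le> (\<Sum>i\<le>Suc b. real (Suc b choose i) * (2 * real (card P)) ^ i)"
  proof (rule sum_mono)
    fix i assume i: "i \<in> {..Suc b}"
    have "esym i (\<lambda>_. 2) P \<le> (\<Sum>p\<in>P. 2) ^ i / fact i" using assms by (intro esym_le) auto
    also have "\<dots> \<le> (2 * real (card P)) ^ i / 1"
      by (intro frac_le) (auto simp: mult.commute)
    also have "\<dots> \<le> real (Suc b choose i) * (2 * real (card P)) ^ i"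
    proof -
      have "Suc b choose i > 0" using i by (simp add: zero_less_binomial_iff)
      then have "1 \<le> real (Suc b choose i)" by linarith
      then show ?thesis using mult_right_mono[of 1 "real (Suc b choose i)" "(2 * real (card P)) ^ i"] by simp
    qed
    finally show "esym i (\<lambda>_. 2) P \<le> real (Suc b choose i) * (2 * real (card P)) ^ i" .
  qed
  also have "\<dots> = (2 * real (card P) + 1) ^ Suc b"
    by (subst binomial_ring) simp
  finally show ?thesis by (simp add: add.commute)
qed

text \<open>Up to the factor 8 this is the exponent of the total cost. The levels grow linearly
  towards the small primes while the weights \<open>2 ^ i\<close> fall geometrically, so the total
  stays below \<open>29 * 2 ^ k\<close>.\<close>

lemma sum_levels: "(\<Sum>i<k. 2 ^ i * (27 + 2 * (k - Suc i))) + 29 + 2 * k = 29 * 2 ^ (k::nat)"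
proof (induction k)
  case (Suc k)
  have "(\<Sum>i<k. 2 ^ i * (27 + 2 * (Suc k - Suc i))) = (\<Sum>i<k. 2 ^ i * (27 + 2 * (k - Suc i)) + 2 * 2 ^ i)"
  proof (rule sum.cong)
    fix i assume "i \<in> {..<k}"
    then have "Suc k - Suc i = Suc (k - Suc i)" by auto
    then show "2 ^ i * (27 + 2 * (Suc k - Suc i)) = 2 ^ i * (27 + 2 * (k - Suc i)) + 2 * (2::nat) ^ i"
      by (simp add: algebra_simps)
  qed simp
  also have "\<dots> = (\<Sum>i<k. 2 ^ i * (27 + 2 * (k - Suc i))) + 2 * (\<Sum>i<k. 2 ^ i)"
    by (simp add: sum.distrib sum_distrib_left)
  also have "(\<Sum>i<k. (2::nat) ^ i) = 2 ^ k - 1"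
    by (induction k) auto
  finally show ?case using Suc by simp
qed simp

text \<open>Block \<open>i\<close> costs at most its upper end \<open>2 ^ (8 * 2 ^ i)\<close> to the
  power \<open>27 + 2 * (k - Suc i)\<close>; then 232 = 8 * 29.\<close>

lemma prod_cost_le: "(\<Prod>i<k. cost (26 + 2 * (k - Suc i)) (block i)) \<le> 2 ^ (232 * 2 ^ k)"
proof -
  have "(\<Prod>i<k. cost (26 + 2 * (k - Suc i)) (block i)) \<le> (\<Prod>i<k. 2 ^ (8 * (2 ^ i * (27 + 2 * (k - Suc i)))))"
  proof (rule prod_mono, intro conjI)
    fix i assume "i \<in> {..<k}"
    let ?b = "26 + 2 * (k - Suc i)"
    show "0 \<le> cost ?b (block i)" unfolding cost_def by (intro msum_nonneg) auto
    have "cost ?b (block i) \<le> (1 + 2 * real (card (block i))) ^ Suc ?b" by (rule cost_le) simp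
    also have "\<dots> \<le> (2 ^ (4 * 2 ^ Suc i)) ^ Suc ?b"
    proof (rule power_mono)
      have "real (1 + 2 * card (block i)) \<le> real (2 ^ (4 * 2 ^ Suc i))"
        using card_block unfolding of_nat_le_iff .
      then show "1 + 2 * real (card (block i)) \<le> 2 ^ (4 * 2 ^ Suc i)" by simp
    qed simp
    also have "\<dots> = 2 ^ (8 * (2 ^ i * (27 + 2 * (k - Suc i))))"
      by (simp only: power_mult[symmetric]) (simp add: algebra_simps)
    finally show "cost ?b (block i) \<le> 2 ^ (8 * (2 ^ i * (27 + 2 * (k - Suc i))))" .
  qed
  also have "\<dots> = 2 ^ (8 * (\<Sum>i<k. 2 ^ i * (27 + 2 * (k - Suc i))))"
    by (simp add: power_sum[symmetric] sum_distrib_left)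
  also have "\<dots> \<le> 2 ^ (232 * 2 ^ k)"
    using sum_levels[of k] by (intro power_increasing) auto
  finally show ?thesis .
qed

text \<open>A geometric series read from the last block downwards: 3/160 * 16/15 = 1/50.\<close>

lemma sum_ratio_le:
  "(\<Sum>i<k. esym (Suc (26 + 2 * (k - Suc i))) (dens N) (block i) / bonf (26 + 2 * (k - Suc i)) (dens N) (block i)) \<le> 1 / 50"
proof -
  have "(\<Sum>i<k. esym (Suc (26 + 2 * (k - Suc i))) (dens N) (block i) / bonf (26 + 2 * (k - Suc i)) (dens N) (block i))
      \<le> (\<Sum>i<k. 3 / 160 * (1 / 16) ^ (k - Suc i))"
    by (intro sum_mono esym_bonf_ratio)
  also have "\<dots> = 3 / 160 * (\<Sum>i<k. (1 / 16) ^ i)"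
    unfolding sum_distrib_left[symmetric] by (subst sum.nat_diff_reindex) simp
  also have "(\<Sum>i<k. (1 / 16) ^ i) = 16 / 15 * (1 - (1 / 16 :: real) ^ k)"
    by (induction k) (simp_all add: algebra_simps)
  also have "3 / 160 * (16 / 15 * (1 - (1 / 16 :: real) ^ k)) \<le> 3 / 160 * (16 / 15 * 1)"
    by (intro mult_left_mono) auto
  finally show ?thesis by simp
qed


section \<open>Prime powers dividing sifted numbers\<close>

text \<open>As \<open>y\<^sup>2 \<ge> N\<close>, at most one prime power above \<open>y\<close> divides \<open>n\<close> exactly.\<close>

lemma Omega_le_split:
  assumes "0 < n" "n < N" "N \<le> y ^ 2"
  shows "\<Omega> n \<le> card {(p, a). prime p \<and> 1 \<le> a \<and> p ^ a \<le> y \<and> p ^ a dvd n} + 1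
    + card {(p, a). prime p \<and> 1 \<le> a \<and> y < p ^ a \<and> p ^ Suc a dvd n}"
proof -
  let ?D = "{(p, a). prime p \<and> 1 \<le> a \<and> p ^ a dvd n}"
  let ?A = "{(p, a). prime p \<and> 1 \<le> a \<and> p ^ a \<le> y \<and> p ^ a dvd n}"
  let ?B = "{(p, a). prime p \<and> 1 \<le> a \<and> y < p ^ a \<and> p ^ Suc a dvd n}"
  let ?C = "{(p, a). prime p \<and> 1 \<le> a \<and> y < p ^ a \<and> p ^ a dvd n \<and> \<not> p ^ Suc a dvd n}"
  have "finite ?D" using assms by (intro finite_Omega_pairs)
  moreover have D: "?D = ?A \<union> ?B \<union> ?C"
  proof -
    have "p ^ a dvd n" if "p ^ Suc a dvd n" for p a
      using that dvd_mult_right[of p "p ^ a" n] by simp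
    then show ?thesis by (auto simp: not_le simp del: power_Suc)
  qed
  ultimately have fin: "finite ?A" "finite ?B" "finite ?C" by simp_all
  have eq: "x = x'" if "x \<in> ?C" "x' \<in> ?C" for x x'
  proof -
    obtain p a q b where x: "x = (p, a)" "x' = (q, b)" by (metis surj_pair)
    have pq: "prime p" "prime q" "y < p ^ a" "y < q ^ b" "p ^ a dvd n" "q ^ b dvd n"
      "\<not> p ^ Suc a dvd n" "\<not> q ^ Suc b dvd n"
      using that x by auto
    have "p = q"
    proof (rule ccontr)
      assume "p \<noteq> q"
      then have "coprime (p ^ a) (q ^ b)" using pq by (simp add: primes_coprime)
      then have "p ^ a * q ^ b dvd n" using pq by (intro divides_mult)
      then have "p ^ a * q ^ b \<le> n" using assms by (intro dvd_imp_le)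
      moreover have "y * y \<le> p ^ a * q ^ b" using pq by (intro mult_mono) auto
      ultimately show False using assms by (simp add: power2_eq_square)
    qed
    moreover have "a = b"
    proof (rule ccontr)
      assume "a \<noteq> b"
      then have "Suc a \<le> b \<or> Suc b \<le> a" by linarith
      then show False
        using pq \<open>p = q\<close> by (metis le_imp_power_dvd dvd_trans)
    qed
    ultimately show ?thesis using x by simp
  qed
  have "card ?C \<le> Suc 0"
    by (subst card_le_Suc0_iff_eq[OF fin(3)], intro ballI) (rule eq)
  moreover have "\<Omega> n \<le> card ?A + card ?B + card ?C"
  proof -
    have "\<Omega> n = card (?A \<union> ?B \<union> ?C)" using big_Omega_eq_card[OF assms(1)] by (simp only: D)
    also have "\<dots> \<le> card (?A \<union> ?B) + card ?C" by (rule card_Un_le)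
    also have "\<dots> \<le> card ?A + card ?B + card ?C" by (intro add_right_mono card_Un_le)
    finally show ?thesis .
  qed
  ultimately show ?thesis by linarith
qed

text \<open>If \<open>y < p ^ a\<close> and \<open>p ^ Suc a\<close> divides
  \<open>n < Z * y\<close>, then \<open>p < Z\<close>. So there are at most \<open>Z * L\<close>
  pairs, and each power \<open>p ^ Suc a >= y\<close> has at most \<open>Z\<close> multiples below
  \<open>N\<close>. Sifting is ignored.\<close>

lemma sum_large_powers_le:
  assumes "N \<le> Z * y" "N < 2 ^ L"
  shows "(\<Sum>n\<in>{1..<N}. real (card {(p, a). prime p \<and> 1 \<le> a \<and> y < p ^ a \<and> p ^ Suc a dvd n}))
    \<le> real L * real Z ^ 2"
proof -
  let ?R = "{x \<in> {1..<Z} \<times> {1..L}. y < fst x ^ snd x}"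
  have "(\<Sum>n\<in>{1..<N}. real (card {(p, a). prime p \<and> 1 \<le> a \<and> y < p ^ a \<and> p ^ Suc a dvd n}))
      \<le> (\<Sum>n\<in>{1..<N}. real (card {x \<in> ?R. fst x ^ Suc (snd x) dvd n}))"
  proof (intro sum_mono, unfold of_nat_le_iff, rule card_mono)
    fix n assume n: "n \<in> {1..<N}"
    show "finite {x \<in> ?R. fst x ^ Suc (snd x) dvd n}" by simp
    have "p < Z \<and> a \<le> L" if p: "prime p" "1 \<le> a" "y < p ^ a" "p ^ Suc a dvd n" for p a
    proof
      have "p * p ^ a \<le> n" using p n by (intro dvd_imp_le) auto
      moreover have "p * y \<le> p * p ^ a" using p by (intro mult_le_mono2) simp
      moreover have "n < Z * y" using n assms(1) by simp
      ultimately have "p * y < Z * y" by linarith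
      then show "p < Z" by simp
      have "p ^ a dvd n" using p dvd_mult_right[of p "p ^ a" n] by simp
      then show "a \<le> L" using prime_power_dvd_bound[of p a n L] p n assms(2) by auto
    qed
    then show "{(p, a). prime p \<and> 1 \<le> a \<and> y < p ^ a \<and> p ^ Suc a dvd n} \<subseteq> {x \<in> ?R. fst x ^ Suc (snd x) dvd n}"
      using prime_gt_0_nat by (auto simp: Suc_le_eq)
  qed
  also have "\<dots> = (\<Sum>x\<in>?R. real (card {n \<in> {1..<N}. fst x ^ Suc (snd x) dvd n}))"
    by (rule sum_card_swap) auto
  also have "\<dots> \<le> (\<Sum>x\<in>?R. real Z)"
  proof (rule sum_mono)
    fix x assume x: "x \<in> ?R"
    then have "y \<le> fst x ^ Suc (snd x)"
      using mult_le_mono[of 1 "fst x" y "fst x ^ snd x"] by auto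
    moreover have pos: "fst x ^ Suc (snd x) > 0" using x by auto
    ultimately have "N - 1 \<le> Z * fst x ^ Suc (snd x)"
      using assms(1) mult_le_mono2[of y "fst x ^ Suc (snd x)" Z] by linarith
    then have "real (N - 1) \<le> real Z * real (fst x ^ Suc (snd x))"
      unfolding of_nat_mult[symmetric] of_nat_le_iff .
    then have "real (N - 1) / real (fst x ^ Suc (snd x)) \<le> real Z"
      using pos by (subst pos_divide_le_eq) auto
    then show "real (card {n \<in> {1..<N}. fst x ^ Suc (snd x) dvd n}) \<le> real Z"
      using card_dvd_less[OF pos, of N] by linarith
  qed
  also have "\<dots> = real (card ?R) * real Z" by simp
  also have "\<dots> \<le> real (Z * L) * real Z"
  proof (intro mult_right_mono, unfold of_nat_le_iff)
    have "card ?R \<le> card ({1..<Z} \<times> {1..L})" by (intro card_mono) auto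
    also have "\<dots> \<le> Z * L" by (simp add: card_cartesian_product)
    finally show "card ?R \<le> Z * L" .
  qed simp
  also have "\<dots> = real L * real Z ^ 2" by (simp add: power2_eq_square)
  finally show ?thesis .
qed

lemma primes_le_16: "primes_le 16 \<subseteq> {2, 3, 5, 7, 11, 13}"
proof
  fix p :: nat assume "p \<in> primes_le 16"
  then have p: "prime p" "p \<ge> 2" "p \<le> 16" by (auto dest: prime_ge_2_nat)
  show "p \<in> {2, 3, 5, 7, 11, 13}"
  proof (cases "p \<le> 3")
    case True
    then have "p = 2 \<or> p = 3" using p by linarith
    then show ?thesis by auto
  next
    case False
    then have "odd p" "\<not> 3 dvd p"
      using p prime_odd_nat[of p] primes_dvd_imp_eq[of 3 p] by auto
    then show ?thesis using False p(3) unfolding insert_iff empty_iff by presburger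
  qed
qed

text \<open>The primes up to 16 contribute at most the sum of their \<open>1 / (p - 1)\<close>,
  which is 21/10. For the larger ones the exponents have ratio at most 132, which the summand 1
  raises to at most 133, below \<open>exp 5\<close>.\<close>

lemma sum_unsifted_le:
  assumes "m \<ge> 32" "m \<le> l" "l \<ge> 128" "l \<le> 132 * m"
  shows "(\<Sum>p\<in>primes_le 16 \<union> {p. prime p \<and> 2 ^ m < p \<and> p \<le> 2 ^ l}. 1 / real p + 1 / (real p * (real p - 1))) \<le> 47 / 5"
proof -
  let ?f = "\<lambda>p. 1 / real p + 1 / (real p * (real p - 1))"
  let ?T = "{p. prime p \<and> 2 ^ m < p \<and> p \<le> (2::nat) ^ l}"
  have finT: "finite ?T" by (rule finite_subset[of _ "{..2 ^ l}"]) auto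
  have m10: "(2::nat) ^ 10 \<le> 2 ^ m" using assms by (intro power_increasing) auto
  then have disj: "primes_le 16 \<inter> ?T = {}" by auto
  have "sum ?f (primes_le 16) \<le> sum ?f {2, 3, 5, 7, 11, 13}"
    using primes_le_16 by (intro sum_mono2) auto
  also have "\<dots> = 21 / 10" by simp
  finally have 1: "sum ?f (primes_le 16) \<le> 21 / 10" .
  have "(\<Sum>p\<in>?T. 1 / real p) = prime_harm (2 ^ l) - prime_harm (2 ^ m)"
    using assms by (intro sum_primes_between power_increasing) auto
  also have "\<dots> \<le> 5 + 5 / 4 * (1 + 2 / real l) + 39 / 40"
  proof (rule prime_harm_diff)
    have "1 * 1 \<le> (3 / 2) * ln (2::real)" using ln2_ge_two_thirds by simp
    also have "\<dots> \<le> real m * ln 2" using assms by (intro mult_right_mono) auto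
    finally have "1 \<le> real m * ln 2" by simp
    moreover have "real l \<le> 132 * real m" using assms(4) by linarith
    then have "real l * ln 2 \<le> 132 * real m * ln 2" by (intro mult_right_mono) auto
    ultimately have "1 + real l * ln 2 \<le> 133 * (real m * ln 2)" by linarith
    moreover have "133 \<le> exp (5 :: real)"
      using exp_lower_approx[of 5 20] by (simp add: power_divide)
    then have "133 * (real m * ln 2) \<le> exp 5 * (real m * ln 2)" by (intro mult_right_mono) auto
    ultimately show "1 + real l * ln 2 \<le> exp 5 * (real m * ln 2)" by linarith
  qed (use assms in auto)
  also have "2 / real l \<le> 1 / 64" using assms(3) by (simp add: field_simps)
  finally have 2: "(\<Sum>p\<in>?T. 1 / real p) \<le> 5 + 5 / 4 * (1 + 1 / 64) + 39 / 40" by simp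
  have "(\<Sum>p\<in>?T. 1 / (real p * (real p - 1))) \<le> 1 / real (2 ^ m)"
    using finT by (intro sum_inverse_consecutive_le) auto
  also have "\<dots> \<le> 1 / real (2 ^ 10)"
    using m10 unfolding of_nat_le_iff[symmetric, where 'a = real]
    by (intro divide_left_mono) auto
  finally have 3: "(\<Sum>p\<in>?T. 1 / (real p * (real p - 1))) \<le> 1 / 1024" by simp
  have "sum ?f (primes_le 16 \<union> ?T) = sum ?f (primes_le 16) + sum ?f ?T"
    using finT disj by (intro sum.union_disjoint) auto
  also have "sum ?f ?T = (\<Sum>p\<in>?T. 1 / real p) + (\<Sum>p\<in>?T. 1 / (real p * (real p - 1)))"
    by (rule sum.distrib)
  also have "sum ?f (primes_le 16) + \<dots> \<le> 21 / 10 + (5 + 5 / 4 * (1 + 1 / 64) + 39 / 40 + 1 / 1024)"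
    by (intro add_mono 1 2 3)
  also have "\<dots> \<le> 47 / 5" by simp
  finally show ?thesis .
qed


section \<open>The mean over the sifted set for large \<open>N\<close>\<close>

text \<open>The primes from 16 to \<open>2 ^ (4 * 2 ^ k)\<close> are sifted out. The remaining prime
  powers up to \<open>y\<close> contribute at most 47/5 times the main term, and one larger power at
  most 1 for each \<open>n\<close>. What is left of 11 absorbs the loss 1/50 in the lower bound and
  the error terms.\<close>

lemma large_case:
  assumes N: "2 ^ e \<le> N" "N < 2 ^ Suc e" and e: "512 * 2 ^ k \<le> e" "e < 1024 * 2 ^ k" and k: "k \<ge> 3"
  shows "\<exists>a b. a > 0 \<and> b > 0 \<and> N = a + b \<and> \<Omega> (a * b) \<le> 21"
proof (rule exists_of_mean)
  define t :: nat where "t = 2 ^ k"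
  define h where "h = e div 2"
  \<comment> \<open>Above the square root of \<open>N\<close> by enough to make repeated large
    powers rare, yet small enough for the counting error: 16 + 232 + 8 = 256, and
    \<open>256 * t <= h\<close>.\<close>
  define y :: nat where "y = 2 ^ (h + 16 * t)"
  \<comment> \<open>The exponents of \<open>Z\<close> and \<open>y\<close> add up to
    \<open>2 * h + 2\<close>, which is at least \<open>Suc e\<close> for either parity of
    \<open>e\<close>.\<close>
  define Z :: nat where "Z = 2 ^ (h + 2 - 16 * t)"
  define L where "L = Suc e"
  define S where "S = sifted N {..<k} block"
  define b where "b i = 26 + 2 * (k - Suc i)" for i
  define \<Gamma> where "\<Gamma> = (\<Prod>i<k. bonf (b i) (dens N) (block i))"
  define K where "K = (\<Prod>i<k. cost (b i) (block i))"
  have t: "t \<ge> 8" using power_increasing[of 3 k "2::nat"] k by (simp add: t_def)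
  have h: "256 * t \<le> h" "2 * h \<le> e" "e \<le> 2 * h + 1" "h < 512 * t"
    using e by (auto simp: h_def t_def)
  show SI: "sifted N {..<k} block \<subseteq> {1..<N}" by (auto simp: sifted_def)
  show "N - n \<in> sifted N {..<k} block" if "n \<in> sifted N {..<k} block" for n
    using that by (auto simp: sifted_def mult.commute)
  have finS: "finite S" using SI finite_subset unfolding S_def by blast
  have K0: "0 \<le> K"
    unfolding K_def cost_def by (rule prod_nonneg) (simp add: msum_nonneg)
  have ev: "even (b i)" for i by (simp add: b_def)
  have bpos: "bonf (b i) (dens N) (block i) > 0" for i
    using less_le_trans[OF exp_gt_zero bonf_block_ge[OF ev]] .
  have pb: "prime p" if "p \<in> block i" for p i using that by (simp add: block_def)
  have upper: "real (card {n \<in> S. m dvd n}) \<le> real N / real m * \<Gamma> + K"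
    if "m > 0" "\<And>i p. p \<in> block i \<Longrightarrow> i < k \<Longrightarrow> coprime p m" for m
    unfolding S_def \<Gamma>_def K_def
    by (rule sifted_upper) (use that block_disjoint pb ev in auto)
  have lower: "real N * \<Gamma> * (49 / 50) - real (Suc k) * K \<le> real (card S)"
  proof -
    have "real N * \<Gamma> * (1 - (\<Sum>i<k. esym (Suc (b i)) (dens N) (block i) / bonf (b i) (dens N) (block i)))
        - real (Suc (card {..<k})) * K \<le> real (card S)"
      unfolding S_def \<Gamma>_def K_def
      by (rule sifted_lower) (use block_disjoint pb ev bpos in auto)
    moreover have "49 / 50 \<le> 1 - (\<Sum>i<k. esym (Suc (b i)) (dens N) (block i) / bonf (b i) (dens N) (block i))"
      using sum_ratio_le[of k N] unfolding b_def by linarith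
    then have "real N * \<Gamma> * (49 / 50) \<le> real N * \<Gamma> * (1 - (\<Sum>i<k. esym (Suc (b i)) (dens N) (block i) / bonf (b i) (dens N) (block i)))"
      unfolding \<Gamma>_def using bpos by (intro mult_left_mono mult_nonneg_nonneg prod_nonneg) (auto intro: less_imp_le)
    ultimately show ?thesis by simp
  qed
  \<comment> \<open>Contains all prime powers up to \<open>y\<close> that divide some element of
    \<open>S\<close>, as such an element has no prime factor in a block.\<close>
  define R where "R = {x \<in> primes_le y \<times> {1..L}. fst x \<notin> (\<Union>i<k. block i) \<and> fst x ^ snd x \<le> y}"
  have finR: "finite R" unfolding R_def by simp
  have \<Gamma>0: "\<Gamma> \<ge> 0" unfolding \<Gamma>_def using bpos by (intro prod_nonneg) (auto intro: less_imp_le)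
  have N_yy: "N \<le> y ^ 2"
  proof -
    have "N \<le> 2 ^ Suc e" using N by simp
    also have "\<dots> \<le> 2 ^ (2 * (h + 16 * t))" using h t by (intro power_increasing) auto
    finally show ?thesis unfolding y_def by (simp add: power_mult[symmetric] mult.commute)
  qed
  have NZy: "N \<le> Z * y"
  proof -
    have "N \<le> 2 ^ Suc e" using N by simp
    also have "\<dots> \<le> 2 ^ ((h + 2 - 16 * t) + (h + 16 * t))" using h t by (intro power_increasing) auto
    finally show ?thesis unfolding y_def Z_def by (simp only: power_add)
  qed
  have "real (\<Sum>n\<in>S. \<Omega> n) \<le> (\<Sum>n\<in>S. real (card {x \<in> R. fst x ^ snd x dvd n}) + 1 +
      real (card {(p, a). prime p \<and> 1 \<le> a \<and> y < p ^ a \<and> p ^ Suc a dvd n}))"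
    unfolding of_nat_sum
  proof (rule sum_mono)
    fix n assume n: "n \<in> S"
    then have n': "0 < n" "n < N" "n < 2 ^ L" using SI N unfolding S_def L_def by force+
    have "{(p, a). prime p \<and> 1 \<le> a \<and> p ^ a \<le> y \<and> p ^ a dvd n} \<subseteq> {x \<in> R. fst x ^ snd x dvd n}"
    proof -
      have "p \<le> y \<and> a \<le> L \<and> p \<notin> (\<Union>i<k. block i)" if p: "prime p" "1 \<le> a" "p ^ a \<le> y" "p ^ a dvd n" for p a
      proof (intro conjI)
        have "p ^ 1 \<le> p ^ a" using p prime_gt_0_nat by (intro power_increasing) (auto simp: Suc_le_eq)
        then show "p \<le> y" using p by simp
        show "a \<le> L" using prime_power_dvd_bound p n' by blast
        have "p dvd n" using p by (meson dvd_power dvd_trans less_le_trans zero_less_one)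
        then have "p dvd n * (N - n)" by simp
        then show "p \<notin> (\<Union>i<k. block i)" using n unfolding S_def sifted_def by blast
      qed
      then show ?thesis by (auto simp: R_def)
    qed
    then have "card {(p, a). prime p \<and> 1 \<le> a \<and> p ^ a \<le> y \<and> p ^ a dvd n} \<le> card {x \<in> R. fst x ^ snd x dvd n}"
      using finR by (intro card_mono) auto
    then have "\<Omega> n \<le> card {x \<in> R. fst x ^ snd x dvd n} + 1 +
      card {(p, a). prime p \<and> 1 \<le> a \<and> y < p ^ a \<and> p ^ Suc a dvd n}"
      using Omega_le_split[OF n'(1,2) N_yy] by linarith
    then have "real (\<Omega> n) \<le> real (card {x \<in> R. fst x ^ snd x dvd n} + 1 +
      card {(p, a). prime p \<and> 1 \<le> a \<and> y < p ^ a \<and> p ^ Suc a dvd n})"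
      by (simp only: of_nat_le_iff)
    then show "real (\<Omega> n) \<le> real (card {x \<in> R. fst x ^ snd x dvd n}) + 1 +
      real (card {(p, a). prime p \<and> 1 \<le> a \<and> y < p ^ a \<and> p ^ Suc a dvd n})"
      by (simp only: of_nat_add of_nat_1)
  qed
  also have "\<dots> = (\<Sum>n\<in>S. real (card {x \<in> R. fst x ^ snd x dvd n})) + real (card S) +
      (\<Sum>n\<in>S. real (card {(p, a). prime p \<and> 1 \<le> a \<and> y < p ^ a \<and> p ^ Suc a dvd n}))"
    by (simp only: sum.distrib) simp
  also have "(\<Sum>n\<in>S. real (card {(p, a). prime p \<and> 1 \<le> a \<and> y < p ^ a \<and> p ^ Suc a dvd n}))
      \<le> (\<Sum>n\<in>{1..<N}. real (card {(p, a). prime p \<and> 1 \<le> a \<and> y < p ^ a \<and> p ^ Suc a dvd n}))"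
    using SI by (intro sum_mono2) (auto simp: S_def)
  also have "\<dots> \<le> real L * real Z ^ 2"
    using NZy N unfolding L_def by (intro sum_large_powers_le) auto
  also have "(\<Sum>n\<in>S. real (card {x \<in> R. fst x ^ snd x dvd n})) = (\<Sum>x\<in>R. real (card {n \<in> S. fst x ^ snd x dvd n}))"
    by (rule sum_card_swap[OF finS finR])
  also have "\<dots> \<le> (\<Sum>x\<in>R. real N * \<Gamma> * (1 / real (fst x) ^ snd x) + K)"
  proof (rule sum_mono)
    fix x assume x: "x \<in> R"
    then have "prime (fst x)" by (auto simp: R_def)
    have "real (card {n \<in> S. fst x ^ snd x dvd n}) \<le> real N / real (fst x ^ snd x) * \<Gamma> + K"
    proof (rule upper)
      show "fst x ^ snd x > 0" using \<open>prime (fst x)\<close> by (simp add: prime_gt_0_nat)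
      fix i p assume "p \<in> block i" "i < k"
      then have "p \<noteq> fst x" "prime p" using x pb by (auto simp: R_def)
      then show "coprime p (fst x ^ snd x)" using \<open>prime (fst x)\<close> by (simp add: primes_coprime)
    qed
    then show "real (card {n \<in> S. fst x ^ snd x dvd n}) \<le> real N * \<Gamma> * (1 / real (fst x) ^ snd x) + K"
      by simp
  qed
  also have "\<dots> = real N * \<Gamma> * (\<Sum>x\<in>R. 1 / real (fst x) ^ snd x) + real (card R) * K"
    by (simp add: sum.distrib sum_distrib_left)
  also have "\<dots> \<le> real N * \<Gamma> * (47 / 5) + real (y * L) * K"
  proof (intro add_mono mult_left_mono mult_right_mono)
    let ?A = "primes_le 16 \<union> {p. prime p \<and> 2 ^ (4 * t) < p \<and> p \<le> 2 ^ (h + 16 * t)}"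
    have finA: "finite ?A"
      using finite_subset[of "{p. prime p \<and> 2 ^ (4 * t) < p \<and> p \<le> 2 ^ (h + 16 * t)}" "{..2 ^ (h + 16 * t)}"] by auto
    have "R \<subseteq> ?A \<times> {1..L}"
      unfolding R_def UN_block t_def[symmetric] y_def by auto
    then have "(\<Sum>x\<in>R. 1 / real (fst x) ^ snd x) \<le> (\<Sum>x\<in>?A \<times> {1..L}. 1 / real (fst x) ^ snd x)"
      using finA by (intro sum_mono2) auto
    also have "\<dots> = (\<Sum>p\<in>?A. \<Sum>a\<in>{1..L}. 1 / real p ^ a)"
      by (subst sum.cartesian_product) (simp add: split_beta)
    also have "\<dots> \<le> (\<Sum>p\<in>?A. 1 / real p + 1 / (real p * (real p - 1)))"
      by (intro sum_mono sum_inverse_powers_le) (auto dest: prime_ge_2_nat)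
    \<comment> \<open>From \<open>h < 512 * t\<close> follows
      \<open>h + 16 * t <= 132 * (4 * t)\<close>, the required ratio of exponents.\<close>
    also have "\<dots> \<le> 47 / 5"
      using h t by (intro sum_unsifted_le) auto
    finally show "(\<Sum>x\<in>R. 1 / real (fst x) ^ snd x) \<le> 47 / 5" .
    have "card R \<le> card ({1..y} \<times> {1..L})"
      by (intro card_mono) (auto simp: R_def Suc_le_eq prime_gt_0_nat)
    then show "real (card R) \<le> real (y * L)"
      unfolding of_nat_le_iff by (simp add: card_cartesian_product)
    show "0 \<le> K" by (rule K0)
  qed (use \<Gamma>0 in auto)
  finally have total: "real (\<Sum>n\<in>S. \<Omega> n)
    \<le> real N * \<Gamma> * (47 / 5) + real (y * L) * K + real (card S) + real L * real Z ^ 2"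
    by linarith
  \<comment> \<open>The factor 2/5 is 10 * 49/50 - 47/5: one of the eleven copies of
    \<open>card S\<close> pays for the single large prime power, and \<open>lower\<close> is applied
    to the other ten.\<close>
  have error: "10 * real (Suc k) * K + real (y * L) * K + real L * real Z ^ 2 < real N * \<Gamma> * (2 / 5)"
  proof -
    \<comment> \<open>A spare factor: \<open>K\<close>, \<open>y * K\<close> and
      \<open>Z ^ 2\<close> stay below \<open>N\<close> even when multiplied by \<open>D\<close>.
      Being exponential in \<open>t\<close>, it outweighs the remaining factors, which are
      polynomial in \<open>t\<close>.\<close>
    define D :: real where "D = 2 ^ (8 * t)"
    have D: "D > 0" by (simp add: D_def)
    have N2h: "2 ^ (2 * h) \<le> real N"
    proof -
      have "2 ^ (2 * h) \<le> (2::nat) ^ e" using h by (intro power_increasing) auto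
      then have "2 ^ (2 * h) \<le> N" using N by linarith
      then have "real (2 ^ (2 * h)) \<le> real N" by (simp only: of_nat_le_iff)
      then show ?thesis by simp
    qed
    then have N0: "real N > 0" using zero_less_power[of "2::real" "2 * h"] by linarith
    have yK: "real y * K * D \<le> real N"
    proof -
      have "real y * K * D \<le> 2 ^ (h + 16 * t) * 2 ^ (232 * t) * 2 ^ (8 * t)"
        using prod_cost_le[of k] unfolding K_def[symmetric, unfolded b_def] t_def[symmetric] D_def y_def
        by (intro mult_mono) (use K0 in \<open>auto simp: K_def b_def\<close>)
      also have "\<dots> = 2 ^ (h + 256 * t)" by (simp add: power_add[symmetric])
      also have "\<dots> \<le> 2 ^ (2 * h)" using h by (intro power_increasing) auto
      finally show ?thesis using N2h by linarith
    qed
    have KD: "K * D \<le> real N"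
    proof -
      have "1 * (K * D) \<le> real y * (K * D)"
        using K0 D by (intro mult_right_mono) (auto simp: y_def)
      then show ?thesis using yK by (simp add: mult.assoc)
    qed
    have ZD: "real Z ^ 2 * D \<le> real N"
    proof -
      have "real Z ^ 2 * D = 2 ^ ((h + 2 - 16 * t) * 2 + 8 * t)"
        unfolding Z_def D_def by (simp add: power_add power_mult)
      also have "\<dots> \<le> 2 ^ (2 * h)" using h t by (intro power_increasing) auto
      finally show ?thesis using N2h by linarith
    qed
    have "Suc k \<le> t" using less_exp[of k] by (simp add: t_def Suc_le_eq)
    then have k1: "real (Suc k) \<le> real t" by (simp only: of_nat_le_iff)
    have "L \<le> 1024 * t" using e by (simp add: L_def t_def)
    then have L1: "real L \<le> 1024 * real t" by linarith
    have "(10 * real (Suc k) * K + real (y * L) * K + real L * real Z ^ 2) * D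
        = 10 * real (Suc k) * (K * D) + real L * (real y * K * D) + real L * (real Z ^ 2 * D)"
      by (simp add: algebra_simps)
    also have "\<dots> \<le> 10 * real t * real N + 1024 * real t * real N + 1024 * real t * real N"
      using k1 L1 KD yK ZD K0 D by (intro add_mono mult_mono) auto
    also have "\<dots> \<le> real N * (4096 * real t)" using N0 t by (simp add: algebra_simps)
    also have "\<dots> < real N * (\<Gamma> * (2 / 5) * D)"
    proof (intro mult_strict_left_mono N0)
      \<comment> \<open>Each of the \<open>k\<close> blocks keeps at least \<open>exp (- 8)\<close>,
        so \<open>1 / \<Gamma>\<close> is at most \<open>4096 ^ k = t ^ 12\<close>.\<close>
      have "(1 / 4096) ^ k \<le> \<Gamma>"
      proof -
        have "1 / 4096 \<le> bonf (b i) (dens N) (block i)" for i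
        proof -
          have "1 / 4096 \<le> exp (- 8 :: real)" using exp_8_le by (simp add: exp_minus field_simps)
          then show ?thesis using bonf_block_ge[OF ev, of i N i] by linarith
        qed
        then have "(\<Prod>i<k. 1 / 4096) \<le> \<Gamma>" unfolding \<Gamma>_def by (intro prod_mono) auto
        then show ?thesis by simp
      qed
      then have G: "1 \<le> \<Gamma> * 4096 ^ k" by (simp add: power_divide field_simps)
      \<comment> \<open>The power \<open>2 ^ (13 * k + 14)\<close> collects \<open>4096 ^ k\<close>,
        \<open>t = 2 ^ k\<close> and \<open>4 * 4096\<close>. The induction starts at 3, where 53 <=
        64; at 2 the inequality fails.\<close>
      have "13 * k + 14 \<le> 8 * t" using k unfolding t_def
      proof (induction k rule: dec_induct)
        case (step k)
        have "(2::nat) ^ 3 \<le> 2 ^ k" using step by (intro power_increasing) auto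
        then show ?case using step by simp
      qed simp
      then have "(2::real) ^ (13 * k + 14) \<le> D" unfolding D_def by (intro power_increasing) auto
      moreover have "(2::real) ^ (13 * k + 14) = 4096 ^ k * (4 * (4096 * real t))"
      proof -
        have "(2::real) ^ (13 * k + 14) = (2 ^ 12) ^ k * 2 ^ k * 2 ^ 14"
          unfolding power_mult[symmetric] power_add[symmetric] by (simp add: algebra_simps)
        then show ?thesis by (simp add: t_def)
      qed
      ultimately have D4: "4096 ^ k * (4 * (4096 * real t)) \<le> D" by simp
      have "4 * (4096 * real t) \<le> (\<Gamma> * 4096 ^ k) * (4 * (4096 * real t))"
        using mult_right_mono[OF G, of "4 * (4096 * real t)"] by simp
      also have "\<dots> = \<Gamma> * (4096 ^ k * (4 * (4096 * real t)))" by (simp only: mult.assoc)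
      also have "\<dots> \<le> \<Gamma> * D" using D4 \<Gamma>0 by (intro mult_left_mono)
      finally have "4 * (4096 * real t) \<le> \<Gamma> * D" .
      moreover have "\<Gamma> * (2 / 5) * D = 2 / 5 * (\<Gamma> * D)" by simp
      ultimately show "4096 * real t < \<Gamma> * (2 / 5) * D" using t by linarith
    qed
    also have "\<dots> = (real N * \<Gamma> * (2 / 5)) * D" by simp
    finally show ?thesis using D by (simp only: mult_less_cancel_right_pos)
  qed
  show "real (\<Sum>n\<in>sifted N {..<k} block. \<Omega> n) < 11 * real (card (sifted N {..<k} block))"
    using total error lower unfolding S_def by linarith
qed

theorem theorem2:
  fixes N :: nat
  assumes "N \<ge> 2"
  shows "\<exists>a b :: nat. a > 0 \<and> b > 0 \<and> N = a + b \<and> \<Omega> (a * b) \<le> 21"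
proof (cases "N < 2 ^ 4096")
  case True
  then show ?thesis using small_case[OF assms] prime_harm_2_4096 by blast
next
  case False
  obtain e where e: "2 ^ e \<le> N" "N < 2 ^ Suc e"
    using ex_power_ivl1[of 2 N] assms by auto
  have "(2::nat) ^ 4096 < 2 ^ Suc e" using False e by linarith
  then have "4096 < Suc e" by (rule power_less_imp_less_exp[rotated]) simp
  \<comment> \<open>The threshold 4096 = 8 * 512 for the exponent is what yields
    \<open>k >= 3\<close>.\<close>
  then have e8: "8 \<le> e div 512" by simp
  then obtain k where k: "2 ^ k \<le> e div 512" "e div 512 < 2 ^ Suc k"
    using ex_power_ivl1[of 2 "e div 512"] by auto
  have "(2::nat) ^ 3 < 2 ^ Suc k" using k e8 by simp
  then have "3 < Suc k" by (rule power_less_imp_less_exp[rotated]) simp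
  moreover have "512 * 2 ^ k \<le> e" "e < 1024 * 2 ^ k" using k by (auto simp: mult.commute)
  ultimately show ?thesis using large_case[OF e] by simp
qed

end
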